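(* Let $c>0$. Assume that $\Phi|_T$ is injective and has closed range and that the non-degenerate source condition (NDSC) holds. Then there is a constant $C>0$ such that for every $\delta>0$, every $z^\delta\in\mathcal{H}$ with $\|z^\delta-z\|_{\mathcal{H}}\le\delta$, and every minimizer $F^\delta$ over $\mathcal{B}_2(\mathcal{H}_1;\mathcal{H}_2)^N$ of $$F\mapsto \frac12\|\Phi F-z^\delta\|_{\mathcal{H}}^2+\lambda\sum_{i=1}^N\|F_i\|_*\qquad\text{with }\lambda=c\delta,$$ one has $\sum_{i=1}^N\|(F^\delta-F^\dagger)_i\|_{\mathrm{HS}}\le C\delta$ (that is, $\sum_{i=1}^N\|(F^\delta-F^\dagger)_i\|_{\mathrm{HS}}=\mathcal{O}(\delta)$).
   Context: $\mathcal{H}_1,\mathcal{H}_2,\mathcal{H}$ are real separable Hilbert spaces. $\mathcal{B}_2(\mathcal{H}_1;\mathcal{H}_2)$ is the Hilbert space of Hilbert–Schmidt operators from $\mathcal{H}_1$ to $\mathcal{H}_2$, with inner product $\langle G,H\rangle=\sum_k\langle Ge_k,He_k\rangle_{\mathcal{H}_2}$ ($\{e_k\}$ an orthonormal basis of $\mathcal{H}_1$) and norm $\|\cdot\|_{\mathrm{HS}}$. For $G\in\mathcal{B}_2(\mathcal{H}_1;\mathcal{H}_2)$, $\|G\|_*\in[0,+\infty]$ is the nuclear norm (sum of the singular values) and $\|G\|$ is the operator norm. For $u\in\mathcal{H}_1$, $v\in\mathcal{H}_2$, $u\otimes v$ denotes the operator $a\mapsto\langle u,a\rangle_{\mathcal{H}_1}v$.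 $N\ge 1$ is an integer. For $1\le i\le N$, $u_i\in\mathcal{H}_1$ and $v_i\in\mathcal{H}_2$ are unit vectors and $\sigma_i>0$; $F^\dagger=(F_i^\dagger)_{1\le i\le N}=(\sigma_iu_i\otimes v_i)_{1\le i\le N}$. $\Phi:\mathcal{B}_2(\mathcal{H}_1;\mathcal{H}_2)^N\to\mathcal{H}$ is a bounded linear operator with adjoint $\Phi^*$, and $z=\Phi F^\dagger$. $T=\prod_{1\le i\le N}T_i$ with $T_i=\{u_i\otimes a+b\otimes v_i:(a,b)\in\mathcal{H}_2\times\mathcal{H}_1\}$. (NDSC): there exists $H=(H_i)_{1\le i\le N}\in\mathrm{Im}(\Phi^* )$ such that for every $1\le i\le N$, $H_i=u_i\otimes v_i+W_i$ with $W_iu_i=0$, $W_i^*v_i=0$ and $\|W_i\|<1$. *)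

theory Defs
  imports "HOL-Analysis.Analysis"
begin

lemma riesz_representation:
  fixes f :: "'a::{real_inner, complete_space} \<Rightarrow> real"
  assumes "bounded_linear f"
  shows "\<exists>y. \<forall>x. f x = x \<bullet> y"
proof -
  interpret f: bounded_linear f by fact
  define g where "g x = 2 * f x - (norm x)\<^sup>2" for x
  define M where "M = (SUP x. g x)"
  have "g x \<le> (onorm f)\<^sup>2" for x
  proof -
    have "f x \<le> onorm f * norm x"
      using onorm[OF assms, of x] by (simp add: abs_le_iff)
    moreover have "0 \<le> (onorm f - norm x)\<^sup>2" by simp
    ultimately show ?thesis
      unfolding g_def by (simp add: power2_eq_square algebra_simps)
  qed
  then have bdd: "bdd_above (range g)" by (rule_tac bdd_aboveI[of _ "(onorm f)\<^sup>2"]) auto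
  then have le_M: "g x \<le> M" for x unfolding M_def by (rule cSUP_upper[OF UNIV_I])
  have "\<exists>x. M - 1 / real (Suc n) < g x" for n
    using less_cSUP_iff[OF _ bdd, of "M - 1 / real (Suc n)"] by (auto simp: M_def)
  then obtain X where X: "\<And>n. M - 1 / real (Suc n) < g (X n)" by metis
  have mid: "(norm (x - y))\<^sup>2 \<le> 2 * (M - g x) + 2 * (M - g y)" for x y
  proof -
    have "g ((1/2) *\<^sub>R (x + y)) = (g x + g y) / 2 + (norm (x - y))\<^sup>2 / 4"
      unfolding g_def power2_norm_eq_inner f.scaleR f.add
      by (simp add: inner_add_left inner_add_right inner_diff_left inner_diff_right
          inner_commute field_simps)
    with le_M[of "(1/2) *\<^sub>R (x + y)"] show ?thesis by (simp add: field_simps)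
  qed
  have "Cauchy X"
  proof (rule metric_CauchyI)
    fix e :: real assume "0 < e"
    then obtain k where k: "inverse (real (Suc k)) < e\<^sup>2 / 4"
      using reals_Archimedean[of "e\<^sup>2 / 4"] by auto
    have "dist (X m) (X n) < e" if "m \<ge> k" "n \<ge> k" for m n
    proof -
      have *: "M - g (X i) < e\<^sup>2 / 4" if "i \<ge> k" for i
      proof -
        have "1 / real (Suc i) \<le> inverse (real (Suc k))"
          using that by (simp add: field_simps)
        with X[of i] k show ?thesis by linarith
      qed
      have "(norm (X m - X n))\<^sup>2 < e\<^sup>2"
        using mid[of "X m" "X n"] *[OF that(1)] *[OF that(2)] by argo
      then show ?thesis using \<open>0 < e\<close> by (simp add: dist_norm power2_less_imp_less)
    qed
    then show "\<exists>k. \<forall>m\<ge>k. \<forall>n\<ge>k. dist (X m) (X n) < e" by blast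
  qed
  then obtain y where y: "X \<longlonglongrightarrow> y" using Cauchy_convergent convergent_def by blast
  have "(\<lambda>n. g (X n)) \<longlonglongrightarrow> g y"
    unfolding g_def by (intro tendsto_intros f.tendsto y)
  moreover have "(\<lambda>n. M - 1 / real (Suc n)) \<longlonglongrightarrow> M - 0"
    by (intro tendsto_diff tendsto_const LIMSEQ_Suc lim_1_over_n)
  ultimately have "M \<le> g y"
    using X by (intro LIMSEQ_le[of _ M]) (auto intro: less_imp_le)
  have "f k = k \<bullet> y" for k
  proof (rule ccontr)
    assume "f k \<noteq> k \<bullet> y"
    define d where "d = f k - k \<bullet> y"
    have "d \<noteq> 0" using \<open>f k \<noteq> k \<bullet> y\<close> by (simp add: d_def)
    have *: "2 * t * d - t\<^sup>2 * (norm k)\<^sup>2 \<le> 0" for t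
    proof -
      have "g (y + t *\<^sub>R k) = g y + 2 * t * d - t\<^sup>2 * (norm k)\<^sup>2"
        unfolding g_def d_def power2_norm_eq_inner f.scaleR f.add
        by (simp add: inner_add_left inner_add_right inner_commute power2_eq_square algebra_simps)
      with le_M[of "y + t *\<^sub>R k"] \<open>M \<le> g y\<close> show ?thesis by simp
    qed
    define p where "p = 1 + (norm k)\<^sup>2"
    have "p > 0" unfolding p_def by (smt (verit) zero_le_power2)
    have "2 * (d / p) * d - (d / p)\<^sup>2 * (norm k)\<^sup>2 = (d\<^sup>2 / p\<^sup>2) * (2 * p - (norm k)\<^sup>2)"
      using \<open>p > 0\<close> by (simp add: field_simps power2_eq_square)
    also have "\<dots> > 0"
    proof -
      have "2 * p - (norm k)\<^sup>2 > 0" unfolding p_def by (smt (verit) zero_le_power2)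
      then show ?thesis using \<open>d \<noteq> 0\<close> \<open>p > 0\<close> by simp
    qed
    finally show False using *[of "d / p"] by simp
  qed
  then show ?thesis by blast
qed

text \<open>The library proves \<open>adjoint_works\<close> only on Euclidean spaces.\<close>

lemma adjoint_works_hilbert:
  fixes f :: "'a::{real_inner, complete_space} \<Rightarrow> 'b::real_inner"
  assumes "bounded_linear f"
  shows "f x \<bullet> y = x \<bullet> adjoint f y"
proof -
  have "\<exists>w. \<forall>x. f x \<bullet> y = x \<bullet> w" for y
    using riesz_representation[of "\<lambda>x. f x \<bullet> y"]
      bounded_linear_compose[OF bounded_linear_inner_left assms] by blast
  then have "\<exists>f'. \<forall>x y. f x \<bullet> y = x \<bullet> f' y" by metis
  from someI_ex[OF this] show ?thesis unfolding adjoint_def by blast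
qed

definition orthonormal :: "'a::real_inner set \<Rightarrow> bool" where
  "orthonormal B \<longleftrightarrow> pairwise orthogonal B \<and> (\<forall>e\<in>B. norm e = 1)"

definition orthonormal_basis :: "'a::real_inner set \<Rightarrow> bool" where
  "orthonormal_basis B \<longleftrightarrow> orthonormal B \<and> closure (span B) = UNIV"

lemma orthonormal_inner:
  "orthonormal B \<Longrightarrow> e \<in> B \<Longrightarrow> e' \<in> B \<Longrightarrow> e \<bullet> e' = (if e = e' then 1 else 0)"
  by (auto simp: orthonormal_def pairwise_def orthogonal_def norm_eq_1)

lemma orthonormal_dist:
  assumes "orthonormal B" "finite F" "F \<subseteq> B"
  shows "(norm (x - (\<Sum>e\<in>F. c e *\<^sub>R e)))\<^sup>2
    = (norm x)\<^sup>2 - (\<Sum>e\<in>F. (x \<bullet> e)\<^sup>2) + (\<Sum>e\<in>F. (x \<bullet> e - c e)\<^sup>2)"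
proof -
  have "(\<Sum>e\<in>F. c e *\<^sub>R e) \<bullet> e' = c e'" if "e' \<in> F" for e'
  proof -
    have "(\<Sum>e\<in>F. c e *\<^sub>R e) \<bullet> e' = (\<Sum>e\<in>F. if e = e' then c e' else 0)"
      unfolding inner_sum_left
      by (rule sum.cong) (use that assms(3) orthonormal_inner[OF assms(1), of _ e'] in \<open>auto simp: subset_iff\<close>)
    then show ?thesis using that assms(2) by simp
  qed
  then have "(\<Sum>e\<in>F. c e *\<^sub>R e) \<bullet> (\<Sum>e\<in>F. c e *\<^sub>R e) = (\<Sum>e\<in>F. (c e)\<^sup>2)"
    unfolding inner_sum_right[of "\<Sum>e\<in>F. c e *\<^sub>R e"]
    by (intro sum.cong) (simp_all add: power2_eq_square)
  moreover have "x \<bullet> (\<Sum>e\<in>F. c e *\<^sub>R e) = (\<Sum>e\<in>F. c e * (x \<bullet> e))"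
    by (simp add: inner_sum_right)
  ultimately show ?thesis
    unfolding power2_norm_eq_inner
    by (simp add: inner_diff_left inner_diff_right inner_commute power2_diff sum.distrib
        sum_subtractf sum_distrib_left sum_negf mult.assoc mult.commute mult.left_commute)
qed

lemma bessel:
  assumes "orthonormal B" "finite F" "F \<subseteq> B"
  shows "(\<Sum>e\<in>F. (x \<bullet> e)\<^sup>2) \<le> (norm x)\<^sup>2"
  using orthonormal_dist[OF assms, of x "\<lambda>e. x \<bullet> e"]
  by simp (metis zero_le_power2 diff_ge_0_iff_ge)

lemma parseval:
  assumes "orthonormal_basis B"
  shows "((\<lambda>e. (x \<bullet> e)\<^sup>2) has_sum (norm x)\<^sup>2) B"
proof -
  have on: "orthonormal B" and cl: "closure (span B) = UNIV"
    using assms by (auto simp: orthonormal_basis_def)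
  let ?S = "sum (\<lambda>e. (x \<bullet> e)\<^sup>2) ` {F. finite F \<and> F \<subseteq> B}"
  have bdd: "bdd_above ?S"
    using bessel[OF on] by (auto intro!: bdd_aboveI)
  have "Sup ?S = (norm x)\<^sup>2"
  proof (rule antisym)
    show "Sup ?S \<le> (norm x)\<^sup>2"
      by (rule cSup_least) (use bessel[OF on] in auto)
    show "(norm x)\<^sup>2 \<le> Sup ?S"
    proof (rule field_le_epsilon)
      fix e :: real assume "0 < e"
      have "x \<in> closure (span B)" using cl by simp
      then obtain y where y: "y \<in> span B" "dist y x < sqrt e"
        using \<open>0 < e\<close> by (metis closure_approachable real_sqrt_gt_zero)
      then obtain F c where F: "finite F" "F \<subseteq> B" "y = (\<Sum>e\<in>F. c e *\<^sub>R e)"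
        by (auto simp: span_explicit)
      have "(norm x)\<^sup>2 - (\<Sum>e\<in>F. (x \<bullet> e)\<^sup>2) \<le> (norm (x - y))\<^sup>2"
        unfolding F(3) orthonormal_dist[OF on F(1,2)] by (simp add: sum_nonneg)
      also have "\<dots> \<le> (sqrt e)\<^sup>2"
        using y(2) by (intro power_mono) (auto simp: dist_norm norm_minus_commute)
      also have "\<dots> = e" using \<open>0 < e\<close> by simp
      finally have "(norm x)\<^sup>2 \<le> (\<Sum>e\<in>F. (x \<bullet> e)\<^sup>2) + e" by simp
      also have "(\<Sum>e\<in>F. (x \<bullet> e)\<^sup>2) \<le> Sup ?S"
        by (rule cSup_upper) (use F bdd in auto)
      finally show "(norm x)\<^sup>2 \<le> Sup ?S + e" by simp
    qed
  qed
  moreover have "((\<lambda>e. (x \<bullet> e)\<^sup>2) has_sum Sup ?S) B"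
    by (rule nonneg_bdd_above_has_sum) (use bdd in \<open>auto simp: conj_commute\<close>)
  ultimately show ?thesis by simp
qed

text \<open>Gram--Schmidt applied to a dense sequence; entries that become \<open>0\<close> are dropped.\<close>

lemma orthonormal_basis_exists:
  "\<exists>B :: 'a::{real_inner, second_countable_topology} set. orthonormal_basis B"
proof -
  obtain D :: "'a set" where D: "countable D" "\<And>X. open X \<Longrightarrow> X \<noteq> {} \<Longrightarrow> \<exists>d\<in>D. d \<in> X"
    using countable_dense_exists by blast
  have "D \<noteq> {}" using D(2)[of UNIV] by auto
  define d where "d = from_nat_into D"
  have range_d: "range d = D" using range_from_nat_into[OF \<open>D \<noteq> {}\<close> D(1)] by (simp add: d_def)
  define step where "step n h = sgn (d n - (\<Sum>m<n. (d n \<bullet> h m) *\<^sub>R h m))" for n h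
  define g where "g = wfrec less_than (\<lambda>h n. step n h)"
  have g: "g n = sgn (d n - (\<Sum>m<n. (d n \<bullet> g m) *\<^sub>R g m))" for n
  proof -
    have "g n = step n (cut g less_than n)"
      unfolding g_def by (subst wfrec) auto
    also have "\<dots> = step n g"
      unfolding step_def by (auto simp: cut_def intro!: arg_cong[of _ _ sgn] sum.cong)
    finally show ?thesis by (simp add: step_def)
  qed
  have gg: "g k \<bullet> g k = 1 \<or> g k = 0" for k
  proof -
    obtain w where "g k = sgn w" using g by blast
    then show ?thesis by (cases "w = 0") (simp_all add: norm_sgn flip: norm_eq_1)
  qed
  have orth: "k < n \<Longrightarrow> g n \<bullet> g k = 0" for k n
  proof (induction n arbitrary: k rule: less_induct)
    case (less n)
    have pair: "g m \<bullet> g k = 0" if "m < n" "m \<noteq> k" for m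
      using less.IH[of m k] less.IH[of k m] that less.prems
      by (metis inner_commute linorder_neqE_nat)
    have "(\<Sum>m<n. (d n \<bullet> g m) *\<^sub>R g m) \<bullet> g k = (\<Sum>m<n. (d n \<bullet> g m) * (g m \<bullet> g k))"
      by (simp add: inner_sum_left)
    also have "\<dots> = (\<Sum>m<n. if m = k then (d n \<bullet> g k) * (g k \<bullet> g k) else 0)"
      by (rule sum.cong) (use pair in auto)
    also have "\<dots> = d n \<bullet> g k"
      using less.prems gg[of k] by auto
    finally show ?case
      unfolding g[of n] by (simp add: sgn_div_norm inner_diff_left)
  qed
  define B where "B = range g - {0}"
  have "orthonormal B"
    unfolding orthonormal_def pairwise_def orthogonal_def B_def
  proof (intro conjI ballI impI)
    fix a b assume ab: "a \<in> range g - {0}" "b \<in> range g - {0}" "a \<noteq> b"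
    then obtain n k where "a = g n" "b = g k" "n \<noteq> k" by blast
    then show "a \<bullet> b = 0" using orth by (metis inner_commute linorder_neqE_nat)
  next
    fix a assume "a \<in> range g - {0}"
    then show "norm a = 1" using gg by (auto simp: norm_eq_1)
  qed
  moreover have "closure (span B) = UNIV"
  proof -
    have gB: "g n \<in> span B" for n
      by (cases "g n = 0") (auto simp: B_def span_zero intro: span_base)
    have "d n \<in> span B" for n
    proof -
      let ?w = "d n - (\<Sum>m<n. (d n \<bullet> g m) *\<^sub>R g m)"
      have "?w = norm ?w *\<^sub>R g n"
        unfolding g[of n] by (cases "?w = 0") (simp_all add: sgn_div_norm)
      then have "?w \<in> span B" by (metis gB span_scale)
      moreover have "(\<Sum>m<n. (d n \<bullet> g m) *\<^sub>R g m) \<in> span B"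
        by (intro span_sum span_scale gB)
      ultimately have "?w + (\<Sum>m<n. (d n \<bullet> g m) *\<^sub>R g m) \<in> span B" by (rule span_add)
      then show ?thesis by simp
    qed
    then have "D \<subseteq> span B" using range_d by auto
    moreover have "closure D = UNIV"
      using D(2) by (auto simp: closure_approachable) (metis centre_in_ball empty_iff mem_ball open_ball dist_commute)
    ultimately show ?thesis using closure_mono by blast
  qed
  ultimately show ?thesis unfolding orthonormal_basis_def by blast
qed

text \<open>Up to transposition, \<open>\<Sum>\<^sub>e \<parallel>G e\<parallel>\<^sup>2\<close> does not depend on the basis.\<close>

lemma hilbert_schmidt_transpose:
  assumes B: "orthonormal_basis B" and C: "orthonormal_basis C"
    and adj: "\<And>x y. G x \<bullet> y = x \<bullet> A y"
    and sA: "(\<lambda>f. (norm (A f))\<^sup>2) summable_on C"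
  shows "(\<lambda>e. (norm (G e))\<^sup>2) summable_on B"
    and "(\<Sum>\<^sub>\<infinity>e\<in>B. (norm (G e))\<^sup>2) \<le> (\<Sum>\<^sub>\<infinity>f\<in>C. (norm (A f))\<^sup>2)"
proof -
  have B': "orthonormal B" using B by (simp add: orthonormal_basis_def)
  have le: "(\<Sum>e\<in>F. (norm (G e))\<^sup>2) \<le> (\<Sum>\<^sub>\<infinity>f\<in>C. (norm (A f))\<^sup>2)"
    if F: "finite F" "F \<subseteq> B" for F
  proof -
    have "((\<lambda>f. \<Sum>e\<in>F. (G e \<bullet> f)\<^sup>2) has_sum (\<Sum>e\<in>F. (norm (G e))\<^sup>2)) C"
      by (induction F rule: infinite_finite_induct) (auto intro!: has_sum_add parseval C)
    moreover have "(\<Sum>e\<in>F. (G e \<bullet> f)\<^sup>2) \<le> (norm (A f))\<^sup>2" for f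
      using bessel[OF B' F, of "A f"] by (simp add: adj inner_commute[of "A f"])
    ultimately show ?thesis
      using has_sum_mono[OF _ has_sum_infsum[OF sA]] by blast
  qed
  show s: "(\<lambda>e. (norm (G e))\<^sup>2) summable_on B"
    by (rule nonneg_bdd_above_summable_on) (use le in \<open>auto intro!: bdd_aboveI\<close>)
  show "(\<Sum>\<^sub>\<infinity>e\<in>B. (norm (G e))\<^sup>2) \<le> (\<Sum>\<^sub>\<infinity>f\<in>C. (norm (A f))\<^sup>2)"
    by (rule infsum_le_finite_sums[OF s]) (use le in auto)
qed

lemma hilbert_schmidt_basis_indep:
  fixes G :: "'a::{real_inner, banach, second_countable_topology} \<Rightarrow> 'b::{real_inner, banach, second_countable_topology}"
  assumes "bounded_linear G" and B: "orthonormal_basis B" and B': "orthonormal_basis B'"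
    and s: "(\<lambda>e. (norm (G e))\<^sup>2) summable_on B"
  shows "(\<lambda>e. (norm (G e))\<^sup>2) summable_on B'"
    and "(\<Sum>\<^sub>\<infinity>e\<in>B'. (norm (G e))\<^sup>2) = (\<Sum>\<^sub>\<infinity>e\<in>B. (norm (G e))\<^sup>2)"
proof -
  obtain C :: "'b set" where C: "orthonormal_basis C" using orthonormal_basis_exists by blast
  note adj = adjoint_works_hilbert[OF assms(1)]
  have adj': "adjoint G y \<bullet> x = y \<bullet> G x" for x y
    using adj[of x y] by (simp add: inner_commute)
  note 1 = hilbert_schmidt_transpose[OF C B adj' s]
  note 2 = hilbert_schmidt_transpose[OF B' C adj 1(1)]
  note 3 = hilbert_schmidt_transpose[OF C B' adj' 2(1)]
  note 4 = hilbert_schmidt_transpose[OF B C adj 1(1)]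
  note 5 = hilbert_schmidt_transpose[OF B C adj 3(1)]
  show "(\<lambda>e. (norm (G e))\<^sup>2) summable_on B'" by (rule 2)
  show "(\<Sum>\<^sub>\<infinity>e\<in>B'. (norm (G e))\<^sup>2) = (\<Sum>\<^sub>\<infinity>e\<in>B. (norm (G e))\<^sup>2)"
    using 1(2) 2(2) 3(2) 4(2) by linarith
qed

text \<open>A fixed orthonormal basis; nothing below depends on the choice, see
  \<open>hilbert_schmidt_iff\<close>, \<open>norm_hs_sq\<close> and \<open>inner_hs_eq\<close>.\<close>

definition some_onb :: "'a::{real_inner, banach, second_countable_topology} set" where
  "some_onb = (SOME B. orthonormal_basis B)"

lemma orthonormal_basis_some_onb: "orthonormal_basis some_onb"
  unfolding some_onb_def by (rule someI_ex[OF orthonormal_basis_exists])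

definition hilbert_schmidt ::
    "('a::{real_inner, banach, second_countable_topology} \<Rightarrow> 'b::{real_inner, banach, second_countable_topology}) \<Rightarrow> bool" where
  "hilbert_schmidt G \<longleftrightarrow> bounded_linear G \<and> (\<lambda>e. (norm (G e))\<^sup>2) summable_on some_onb"

lemma hilbert_schmidt_iff:
  "orthonormal_basis B \<Longrightarrow>
    hilbert_schmidt G \<longleftrightarrow> bounded_linear G \<and> (\<lambda>e. (norm (G e))\<^sup>2) summable_on B"
  using hilbert_schmidt_basis_indep(1)[OF _ orthonormal_basis_some_onb]
    hilbert_schmidt_basis_indep(1)[OF _ _ orthonormal_basis_some_onb]
  unfolding hilbert_schmidt_def by blast

lemma hilbert_schmidt_zero: "hilbert_schmidt (\<lambda>x. 0)"
  by (simp add: hilbert_schmidt_def bounded_linear_zero)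

lemma summable_on_norm2_add:
  fixes f g :: "'i \<Rightarrow> 'b::real_inner"
  assumes "(\<lambda>e. (norm (f e))\<^sup>2) summable_on B" "(\<lambda>e. (norm (g e))\<^sup>2) summable_on B"
  shows "(\<lambda>e. (norm (f e + g e))\<^sup>2) summable_on B"
proof (rule summable_on_comparison_test)
  show "(\<lambda>e. 2 * (norm (f e))\<^sup>2 + 2 * (norm (g e))\<^sup>2) summable_on B"
    by (intro summable_on_add summable_on_cmult_right assms)
  show "(norm (f e + g e))\<^sup>2 \<le> 2 * (norm (f e))\<^sup>2 + 2 * (norm (g e))\<^sup>2" for e
  proof -
    have "0 \<le> (norm (f e - g e))\<^sup>2" by simp
    then show ?thesis
      unfolding power2_norm_eq_inner
      by (simp add: inner_add_left inner_add_right inner_diff_left inner_diff_right inner_commute)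
  qed
qed auto

lemma hilbert_schmidt_add:
  "hilbert_schmidt F \<Longrightarrow> hilbert_schmidt G \<Longrightarrow> hilbert_schmidt (\<lambda>x. F x + G x)"
  by (auto simp: hilbert_schmidt_def intro!: bounded_linear_add summable_on_norm2_add)

lemma hilbert_schmidt_scaleR:
  "hilbert_schmidt G \<Longrightarrow> hilbert_schmidt (\<lambda>x. r *\<^sub>R G x)"
  by (auto simp: hilbert_schmidt_def power_mult_distrib intro!: summable_on_cmult_right
      intro: bounded_linear_compose[OF bounded_linear_scaleR_right])

lemma hilbert_schmidt_uminus: "hilbert_schmidt G \<Longrightarrow> hilbert_schmidt (\<lambda>x. - G x)"
  using hilbert_schmidt_scaleR[of G "-1"] by simp

lemma hilbert_schmidt_diff:
  "hilbert_schmidt F \<Longrightarrow> hilbert_schmidt G \<Longrightarrow> hilbert_schmidt (\<lambda>x. F x - G x)"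
  using hilbert_schmidt_add[OF _ hilbert_schmidt_uminus] by fastforce

lemma hilbert_schmidt_summable_inner:
  assumes "hilbert_schmidt F" "hilbert_schmidt G" "orthonormal_basis B"
  shows "(\<lambda>e. F e \<bullet> G e) summable_on B"
proof -
  have *: "(\<lambda>e. (norm (H e))\<^sup>2) summable_on B" if "hilbert_schmidt H" for H
    using that hilbert_schmidt_iff[OF assms(3)] by blast
  have "(\<lambda>e. (1/4) * (norm (F e + G e))\<^sup>2 + (-1/4) * (norm (F e - G e))\<^sup>2) summable_on B"
    by (intro summable_on_add summable_on_cmult_right * hilbert_schmidt_add hilbert_schmidt_diff assms)
  then show ?thesis by (simp add: power2_norm_eq_inner inner_add_left inner_add_right
      inner_diff_left inner_diff_right inner_commute field_simps)
qed

text \<open>\<open>('a, 'b) hs\<close> is the space of Hilbert--Schmidt operators: its \<open>norm\<close> is the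
  Hilbert--Schmidt norm, while the operator norm of \<open>G\<close> is \<open>norm (blinfun_of_hs G)\<close>.\<close>

typedef (overloaded) ('a::"{real_inner, banach, second_countable_topology}", 'b::"{real_inner, banach, second_countable_topology}") hs =
    "{G :: 'a \<Rightarrow>\<^sub>L 'b. hilbert_schmidt (blinfun_apply G)}"
  morphisms blinfun_of_hs Abs_hs
  by (rule exI[of _ 0]) (simp add: zero_blinfun.rep_eq hilbert_schmidt_zero)

setup_lifting type_definition_hs

abbreviation hs_apply :: "('a::{real_inner, banach, second_countable_topology}, 'b::{real_inner, banach, second_countable_topology}) hs \<Rightarrow> 'a \<Rightarrow> 'b"
  where "hs_apply G \<equiv> blinfun_apply (blinfun_of_hs G)"

lemma hs_eqI: "(\<And>x. hs_apply F x = hs_apply G x) \<Longrightarrow> F = G"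
  by (metis blinfun_eqI blinfun_of_hs_inject)

lemma hilbert_schmidt_hs_apply: "hilbert_schmidt (hs_apply G)"
  using blinfun_of_hs[of G] by simp

instantiation hs :: ("{real_inner, banach, second_countable_topology}", "{real_inner, banach, second_countable_topology}") real_inner
begin

lift_definition zero_hs :: "('a, 'b) hs" is 0
  by (simp add: zero_blinfun.rep_eq hilbert_schmidt_zero)

lift_definition plus_hs :: "('a, 'b) hs \<Rightarrow> ('a, 'b) hs \<Rightarrow> ('a, 'b) hs" is "(+)"
  by (simp add: plus_blinfun.rep_eq hilbert_schmidt_add)

lift_definition uminus_hs :: "('a, 'b) hs \<Rightarrow> ('a, 'b) hs" is uminus
  by (simp add: uminus_blinfun.rep_eq hilbert_schmidt_uminus)

lift_definition minus_hs :: "('a, 'b) hs \<Rightarrow> ('a, 'b) hs \<Rightarrow> ('a, 'b) hs" is "(-)"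
  by (simp add: minus_blinfun.rep_eq hilbert_schmidt_diff)

lift_definition scaleR_hs :: "real \<Rightarrow> ('a, 'b) hs \<Rightarrow> ('a, 'b) hs" is scaleR
  by (simp add: scaleR_blinfun.rep_eq hilbert_schmidt_scaleR)

definition inner_hs :: "('a, 'b) hs \<Rightarrow> ('a, 'b) hs \<Rightarrow> real" where
  "inner_hs G H = (\<Sum>\<^sub>\<infinity>e\<in>some_onb. hs_apply G e \<bullet> hs_apply H e)"

definition norm_hs :: "('a, 'b) hs \<Rightarrow> real" where
  "norm_hs G = sqrt (inner G G)"

definition dist_hs :: "('a, 'b) hs \<Rightarrow> ('a, 'b) hs \<Rightarrow> real" where
  "dist_hs F G = norm (F - G)"

definition sgn_hs :: "('a, 'b) hs \<Rightarrow> ('a, 'b) hs" where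
  "sgn_hs G = inverse (norm G) *\<^sub>R G"

definition uniformity_hs :: "(('a, 'b) hs \<times> ('a, 'b) hs) filter" where
  "uniformity_hs = (INF e\<in>{0<..}. principal {(x, y). dist x y < e})"

definition open_hs :: "('a, 'b) hs set \<Rightarrow> bool" where
  "open_hs S = (\<forall>x\<in>S. \<forall>\<^sub>F (x', y) in uniformity. x' = x \<longrightarrow> y \<in> S)"

instance
proof
  note summ = hilbert_schmidt_summable_inner[OF hilbert_schmidt_hs_apply
      hilbert_schmidt_hs_apply orthonormal_basis_some_onb]
  fix F G H :: "('a, 'b) hs" and r s :: real
  show "F + G + H = F + (G + H)" "F + G = G + F" "0 + F = F" "- F + F = 0" "F - G = F + - G"
    "r *\<^sub>R (F + G) = r *\<^sub>R F + r *\<^sub>R G" "(r + s) *\<^sub>R F = r *\<^sub>R F + s *\<^sub>R F"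
    "r *\<^sub>R s *\<^sub>R F = (r * s) *\<^sub>R F" "1 *\<^sub>R F = F"
    by (transfer, simp add: algebra_simps)+
  show "dist F G = norm (F - G)" "sgn F = inverse (norm F) *\<^sub>R F" "norm F = sqrt (inner F F)"
    by (simp_all add: dist_hs_def sgn_hs_def norm_hs_def)
  show "uniformity = (INF e\<in>{0<..}. principal {(x, y :: ('a, 'b) hs). dist x y < e})"
    by (rule uniformity_hs_def)
  show "open S = (\<forall>x\<in>S. \<forall>\<^sub>F (x', y) in uniformity. x' = x \<longrightarrow> y \<in> S)" for S :: "('a, 'b) hs set"
    by (rule open_hs_def)
  show "inner F G = inner G F"
    by (simp add: inner_hs_def inner_commute)
  show "inner (F + G) H = inner F H + inner G H"
    unfolding inner_hs_def plus_hs.rep_eq plus_blinfun.rep_eq inner_add_left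
    by (rule infsum_add[OF summ summ])
  show "inner (r *\<^sub>R F) G = r * inner F G"
    unfolding inner_hs_def scaleR_hs.rep_eq scaleR_blinfun.rep_eq inner_scaleR_left
    by (rule infsum_cmult_right')
  show "0 \<le> inner F F"
    by (simp add: inner_hs_def infsum_nonneg)
  show "inner F F = 0 \<longleftrightarrow> F = 0"
  proof
    assume "inner F F = 0"
    then have "\<forall>e\<in>some_onb. hs_apply F e \<bullet> hs_apply F e = 0"
      using nonneg_infsum_le_0D[OF _ summ, where 'a1='a and 'b1='b, of F F] by (auto simp: inner_hs_def)
    then have "\<And>e. e \<in> some_onb \<Longrightarrow> hs_apply F e = 0" by simp
    then have span0: "hs_apply F x = 0" if "x \<in> span some_onb" for x
      using linear_eq_0_on_span[of "hs_apply F" some_onb x] that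
      by (simp add: blinfun.bounded_linear_right bounded_linear.linear)
    have "closed {x. hs_apply F x = 0}"
      by (intro closed_Collect_eq continuous_intros)
    then have "closure (span some_onb) \<subseteq> {x. hs_apply F x = 0}"
      using span0 by (intro closure_minimal) auto
    then have "hs_apply F x = 0" for x
      using orthonormal_basis_some_onb by (auto simp: orthonormal_basis_def)
    then show "F = 0" by (intro hs_eqI) (simp add: zero_hs.rep_eq)
  next
    assume "F = 0"
    then show "inner F F = 0" by (simp add: inner_hs_def zero_hs.rep_eq)
  qed
qed

end

lemma norm_hs_sq: "orthonormal_basis B \<Longrightarrow> (norm G)\<^sup>2 = (\<Sum>\<^sub>\<infinity>e\<in>B. (norm (hs_apply G e))\<^sup>2)"
  using hilbert_schmidt_basis_indep(2)[OF _ orthonormal_basis_some_onb, of "hs_apply G" B]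
    hilbert_schmidt_hs_apply[of G]
  by (simp add: power2_norm_eq_inner inner_hs_def hilbert_schmidt_def)

lemma inner_hs_eq:
  assumes "orthonormal_basis B"
  shows "inner G H = (\<Sum>\<^sub>\<infinity>e\<in>B. hs_apply G e \<bullet> hs_apply H e)"
proof -
  have h: "((\<lambda>e. (norm (hs_apply K e))\<^sup>2) has_sum (norm K)\<^sup>2) B" for K :: "('a, 'b) hs"
    unfolding norm_hs_sq[OF assms]
    using hilbert_schmidt_hs_apply[of K] hilbert_schmidt_iff[OF assms] by (blast intro: has_sum_infsum)
  have "((\<lambda>e. 1/4 * (norm (hs_apply (G + H) e))\<^sup>2 + -1/4 * (norm (hs_apply (G - H) e))\<^sup>2)
      has_sum 1/4 * (norm (G + H))\<^sup>2 + -1/4 * (norm (G - H))\<^sup>2) B"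
    by (intro has_sum_add has_sum_cmult_right h)
  then have "((\<lambda>e. hs_apply G e \<bullet> hs_apply H e) has_sum inner G H) B"
    by (simp add: power2_norm_eq_inner plus_hs.rep_eq minus_hs.rep_eq blinfun.add_left
      blinfun.diff_left inner_add_left inner_add_right
      inner_diff_left inner_diff_right inner_commute field_simps)
  then show ?thesis by (simp add: infsumI)
qed

lemma norm_blinfun_of_hs_le: "norm (blinfun_of_hs G) \<le> norm G"
proof -
  obtain C :: "'b set" where C: "orthonormal_basis C" using orthonormal_basis_exists by blast
  have "norm (hs_apply G x) \<le> norm G * norm x" for x
  proof -
    let ?A = "adjoint (hs_apply G)"
    have adj: "hs_apply G x \<bullet> y = x \<bullet> ?A y" for x y
      by (rule adjoint_works_hilbert) (rule blinfun.bounded_linear_right)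
    have adj': "?A y \<bullet> x = y \<bullet> hs_apply G x" for x y
      using adj[of x y] by (simp add: inner_commute)
    have "(\<lambda>e. (norm (hs_apply G e))\<^sup>2) summable_on some_onb"
      using hilbert_schmidt_hs_apply[of G] by (simp add: hilbert_schmidt_def)
    note A = hilbert_schmidt_transpose[OF C orthonormal_basis_some_onb adj' this]
    have "(norm (hs_apply G x))\<^sup>2 \<le> (norm x)\<^sup>2 * (\<Sum>\<^sub>\<infinity>f\<in>C. (norm (?A f))\<^sup>2)"
    proof (rule has_sum_mono[OF parseval[OF C]])
      show "((\<lambda>f. (norm x)\<^sup>2 * (norm (?A f))\<^sup>2) has_sum
          (norm x)\<^sup>2 * (\<Sum>\<^sub>\<infinity>f\<in>C. (norm (?A f))\<^sup>2)) C"
        by (intro has_sum_cmult_right has_sum_infsum A)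
      show "(hs_apply G x \<bullet> f)\<^sup>2 \<le> (norm x)\<^sup>2 * (norm (?A f))\<^sup>2" for f
        using Cauchy_Schwarz_ineq[of x "?A f"] by (simp add: adj power2_norm_eq_inner)
    qed
    also have "\<dots> \<le> (norm x)\<^sup>2 * (norm G)\<^sup>2"
      using A(2) by (simp add: norm_hs_sq[OF orthonormal_basis_some_onb] mult_left_mono)
    finally show ?thesis
      by (rule_tac power2_le_imp_le) (auto simp: power_mult_distrib mult.commute)
  qed
  then show ?thesis by (intro norm_blinfun_bound) auto
qed

lemma sum_norm_hs_le:
  assumes "finite F" "F \<subseteq> some_onb"
  shows "(\<Sum>e\<in>F. (norm (hs_apply G e))\<^sup>2) \<le> (norm G)\<^sup>2"
  unfolding norm_hs_sq[OF orthonormal_basis_some_onb]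
  by (rule finite_sum_le_infsum)
    (use assms hilbert_schmidt_hs_apply[of G] in \<open>auto simp: hilbert_schmidt_def\<close>)

lemma hilbert_schmidt_boundI:
  assumes "\<And>F. finite F \<Longrightarrow> F \<subseteq> some_onb \<Longrightarrow> (\<Sum>e\<in>F. (norm (blinfun_apply G e))\<^sup>2) \<le> K"
  obtains G' where "blinfun_of_hs G' = G" "(norm G')\<^sup>2 \<le> K"
proof -
  have s: "(\<lambda>e. (norm (blinfun_apply G e))\<^sup>2) summable_on some_onb"
    by (rule nonneg_bdd_above_summable_on) (use assms in \<open>auto intro!: bdd_aboveI\<close>)
  then have "blinfun_of_hs (Abs_hs G) = G"
    by (intro Abs_hs_inverse) (simp add: hilbert_schmidt_def blinfun.bounded_linear_right)
  moreover from this have "(norm (Abs_hs G))\<^sup>2 \<le> K"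
    unfolding norm_hs_sq[OF orthonormal_basis_some_onb] using infsum_le_finite_sums[OF s assms] by simp
  ultimately show ?thesis using that by blast
qed

instance hs :: ("{real_inner, banach, second_countable_topology}", "{real_inner, banach, second_countable_topology}") banach
proof
  fix X :: "nat \<Rightarrow> ('a, 'b) hs" assume X: "Cauchy X"
  have "Cauchy (\<lambda>n. blinfun_of_hs (X n))"
  proof (rule metric_CauchyI)
    fix e :: real assume "0 < e"
    then obtain N where N: "\<And>m n. m \<ge> N \<Longrightarrow> n \<ge> N \<Longrightarrow> dist (X m) (X n) < e"
      using metric_CauchyD[OF X] by blast
    have "dist (blinfun_of_hs (X m)) (blinfun_of_hs (X n)) \<le> dist (X m) (X n)" for m n
      using norm_blinfun_of_hs_le[of "X m - X n"] by (simp add: dist_norm minus_hs.rep_eq)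
    then show "\<exists>N. \<forall>m\<ge>N. \<forall>n\<ge>N. dist (blinfun_of_hs (X m)) (blinfun_of_hs (X n)) < e"
      using N by (meson le_less_trans)
  qed
  then obtain L where L: "(\<lambda>n. blinfun_of_hs (X n)) \<longlonglongrightarrow> L"
    using Cauchy_convergent convergent_def by blast
  have approx: "\<exists>G. blinfun_of_hs G = L - blinfun_of_hs (X n) \<and> (norm G)\<^sup>2 \<le> e\<^sup>2"
    if N: "\<And>m. m \<ge> N \<Longrightarrow> dist (X m) (X n) < e" and "0 < e" for n N e
  proof -
    have "(\<Sum>e\<in>F. (norm (blinfun_apply (L - blinfun_of_hs (X n)) e))\<^sup>2) \<le> e\<^sup>2"
      if F: "finite F" "F \<subseteq> some_onb" for F
    proof (rule LIMSEQ_le_const2)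
      show "(\<lambda>m. \<Sum>e\<in>F. (norm (blinfun_apply (blinfun_of_hs (X m) - blinfun_of_hs (X n)) e))\<^sup>2)
          \<longlonglongrightarrow> (\<Sum>e\<in>F. (norm (blinfun_apply (L - blinfun_of_hs (X n)) e))\<^sup>2)"
        by (intro tendsto_intros L)
      have "(\<Sum>e\<in>F. (norm (blinfun_apply (blinfun_of_hs (X m) - blinfun_of_hs (X n)) e))\<^sup>2) \<le> e\<^sup>2"
        if "m \<ge> N" for m
      proof -
        have "(norm (X m - X n))\<^sup>2 \<le> e\<^sup>2"
          using N[OF that] by (intro power_mono) (auto simp: dist_norm)
        with sum_norm_hs_le[OF F, of "X m - X n"] show ?thesis by (simp add: minus_hs.rep_eq)
      qed
      then show "\<exists>N. \<forall>m\<ge>N. (\<Sum>e\<in>F. (norm (blinfun_apply (blinfun_of_hs (X m) - blinfun_of_hs (X n)) e))\<^sup>2) \<le> e\<^sup>2"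
        by blast
    qed
    then show ?thesis using hilbert_schmidt_boundI by metis
  qed
  obtain N1 where "\<And>m. m \<ge> N1 \<Longrightarrow> dist (X m) (X N1) < 1"
    using metric_CauchyD[OF X, of 1] by auto
  then obtain G1 where "blinfun_of_hs G1 = L - blinfun_of_hs (X N1)"
    using approx[of N1 N1 1] by auto
  then have G: "blinfun_of_hs (G1 + X N1) = L" by (simp add: plus_hs.rep_eq)
  have "X \<longlonglongrightarrow> G1 + X N1"
  proof (rule metric_LIMSEQ_I)
    fix e :: real assume "0 < e"
    then obtain N where N: "\<And>m n. m \<ge> N \<Longrightarrow> n \<ge> N \<Longrightarrow> dist (X m) (X n) < e/2"
      using metric_CauchyD[OF X, of "e/2"] by auto
    have "dist (X n) (G1 + X N1) < e" if n: "n \<ge> N" for n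
    proof -
      obtain H where H: "blinfun_of_hs H = L - blinfun_of_hs (X n)" "(norm H)\<^sup>2 \<le> (e/2)\<^sup>2"
        using approx[of N n "e/2"] N n \<open>0 < e\<close> by auto
      have "H = G1 + X N1 - X n"
        by (rule iffD1[OF blinfun_of_hs_inject]) (simp only: H(1) minus_hs.rep_eq G)
      moreover have "norm H \<le> e/2"
        by (rule power2_le_imp_le[OF H(2)]) (use \<open>0 < e\<close> in simp)
      ultimately have "norm (G1 + X N1 - X n) < e" using \<open>0 < e\<close> by simp
      then show ?thesis unfolding dist_norm by (subst norm_minus_commute)
    qed
    then show "\<exists>N. \<forall>n\<ge>N. dist (X n) (G1 + X N1) < e" by blast
  qed
  then show "convergent X" by (rule convergentI)
qed

lift_definition hs_tensor ::
    "'a::{real_inner, banach, second_countable_topology} \<Rightarrow> 'b::{real_inner, banach, second_countable_topology} \<Rightarrow> ('a, 'b) hs"  (infix "\<otimes>" 75)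
  is "\<lambda>u v. blinfun_scaleR_left v o\<^sub>L blinfun_inner_right u"
proof -
  fix u :: 'a and v :: 'b
  have "(\<lambda>e. (norm v)\<^sup>2 * (u \<bullet> e)\<^sup>2) summable_on some_onb"
    using parseval[OF orthonormal_basis_some_onb, of u]
    by (intro summable_on_cmult_right) (auto simp: summable_on_def)
  then show "hilbert_schmidt (blinfun_apply (blinfun_scaleR_left v o\<^sub>L blinfun_inner_right u))"
    by (simp add: hilbert_schmidt_def blinfun.bounded_linear_right power_mult_distrib mult.commute)
qed

lemma hs_tensor_apply: "hs_apply (u \<otimes> v) a = (u \<bullet> a) *\<^sub>R v"
  by (simp add: hs_tensor.rep_eq)

text \<open>The singular values are the square roots of the eigenvalues of \<open>G\<^sup>* G\<close>, repeated
  according to multiplicity; zero singular values do not contribute to the nuclear norm and are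
  left out. For \<open>s > 0\<close> the eigenspace is finite-dimensional, as \<open>G\<close> is compact, so \<open>dim\<close> is
  the multiplicity. The sum is taken in \<open>[0, \<infinity>]\<close>.\<close>

definition singular_space ::
    "('a::{real_inner, banach, second_countable_topology},
      'b::{real_inner, banach, second_countable_topology}) hs \<Rightarrow> real \<Rightarrow> 'a set" where
  "singular_space G s = {x. adjoint (hs_apply G) (hs_apply G x) = s\<^sup>2 *\<^sub>R x}"

definition singular_values ::
    "('a::{real_inner, banach, second_countable_topology},
      'b::{real_inner, banach, second_countable_topology}) hs \<Rightarrow> real set" where
  "singular_values G = {s. 0 < s \<and> (\<exists>x\<in>singular_space G s. x \<noteq> 0)}"

definition nuclear_norm ::
    "('a::{real_inner, banach, second_countable_topology},
      'b::{real_inner, banach, second_countable_topology}) hs \<Rightarrow> ennreal" where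
  "nuclear_norm G = (\<Sum>\<^sub>\<infinity>s\<in>singular_values G. of_nat (dim (singular_space G s)) * ennreal s)"

definition tangent_space ::
    "('n::finite \<Rightarrow> 'a::{real_inner, banach, second_countable_topology}) \<Rightarrow>
     ('n \<Rightarrow> 'b::{real_inner, banach, second_countable_topology}) \<Rightarrow> (('a, 'b) hs ^ 'n) set" where
  "tangent_space u v = {F. \<forall>i. \<exists>a b. F $ i = u i \<otimes> a + b \<otimes> v i}"

definition ndsc ::
    "(('a::{real_inner, banach, second_countable_topology},
       'b::{real_inner, banach, second_countable_topology}) hs ^ 'n::finite \<Rightarrow> 'h::real_inner) \<Rightarrow>
     ('n \<Rightarrow> 'a) \<Rightarrow> ('n \<Rightarrow> 'b) \<Rightarrow> bool" where
  "ndsc \<Phi> u v \<longleftrightarrow> (\<exists>H\<in>range (adjoint \<Phi>). \<forall>i. \<exists>W. H $ i = u i \<otimes> v i + W \<and>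
     hs_apply W (u i) = 0 \<and> adjoint (hs_apply W) (v i) = 0 \<and> norm (blinfun_of_hs W) < 1)"

definition objective ::
    "(('a::{real_inner, banach, second_countable_topology},
       'b::{real_inner, banach, second_countable_topology}) hs ^ 'n::finite \<Rightarrow> 'h::real_normed_vector) \<Rightarrow>
     'h \<Rightarrow> real \<Rightarrow> ('a, 'b) hs ^ 'n \<Rightarrow> ennreal" where
  "objective \<Phi> z lam F =
     ennreal (1/2 * (norm (\<Phi> F - z))\<^sup>2) + ennreal lam * (\<Sum>i\<in>UNIV. nuclear_norm (F $ i))"

end

theory Submission
  imports Defs
begin

text \<open>Comparing the objective at the minimizer with its value at \<open>F\<^sub>0\<close> bounds
  \<open>\<parallel>F\<^sub>\<delta>\<parallel>\<^sub>* - \<parallel>F\<^sub>0\<parallel>\<^sub>*\<close>. Conversely \<open>\<langle>K, G\<rangle> \<le> \<parallel>G\<parallel>\<^sub>*\<close> whenever \<open>K\<close> has operator norm at most \<open>1\<close>,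
  and the strict inequality \<open>\<parallel>W\<parallel> < 1\<close> leaves room to add to the dual certificate
  \<open>u \<otimes> v + W\<close> the multiple \<open>1 - \<parallel>W\<parallel>\<close> of the normalized component of \<open>G\<close> normal to \<open>T\<close>.
  Together with the Cauchy--Schwarz inequality this shows that the normal component of \<open>F\<^sub>\<delta>\<close> and
  the residual \<open>\<Phi> F\<^sub>\<delta> - z\<^sub>\<delta>\<close> are \<open>O(\<delta>)\<close>. By the bounded inverse theorem \<open>\<Phi>\<close> is bounded
  below on \<open>T\<close>, so the tangential component of \<open>F\<^sub>\<delta> - F\<^sub>0\<close> is \<open>O(\<delta>)\<close> as well.\<close>

subsection \<open>Orthogonal complements and bounded inverses\<close>

text \<open>The vector is \<open>x - p\<close> for the point \<open>p\<close> of \<open>S\<close>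
  nearest to \<open>x\<close>; completeness supplies \<open>p\<close> as the limit of a minimizing
  sequence.\<close>

lemma closed_subspace_orthogonal_vector:
  fixes S :: "'a::{real_inner, complete_space} set"
  assumes "closed S" "subspace S" "x \<notin> S"
  obtains y where "y \<noteq> 0" "\<And>s. s \<in> S \<Longrightarrow> y \<bullet> s = 0"
proof -
  define m where "m = (INF s\<in>S. (norm (x - s))\<^sup>2)"
  have "0 \<in> S" using assms(2) by (rule subspace_0)
  have bdd: "bdd_below ((\<lambda>s. (norm (x - s))\<^sup>2) ` S)" by (rule bdd_belowI[of _ 0]) auto
  have m_le: "m \<le> (norm (x - s))\<^sup>2" if "s \<in> S" for s
    unfolding m_def by (rule cINF_lower[OF bdd that])
  have "\<exists>s\<in>S. (norm (x - s))\<^sup>2 < m + 1 / real (Suc n)" for n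
    using cINF_less_iff[OF _ bdd, of "m + 1 / real (Suc n)"] \<open>0 \<in> S\<close> by (auto simp: m_def)
  then obtain X where X: "\<And>n. X n \<in> S" "\<And>n. (norm (x - X n))\<^sup>2 < m + 1 / real (Suc n)" by metis
  \<comment> \<open>Parallelogram law: the midpoint of \<open>a\<close> and \<open>b\<close> lies in
    \<open>S\<close>, so its squared distance to \<open>x\<close> is at least \<open>m\<close>.
    Near-minimizers are therefore close to each other.\<close>
  have mid: "(norm (a - b))\<^sup>2 \<le> 2 * ((norm (x - a))\<^sup>2 - m) + 2 * ((norm (x - b))\<^sup>2 - m)"
    if "a \<in> S" "b \<in> S" for a b
  proof -
    have "(norm (x - (1/2) *\<^sub>R (a + b)))\<^sup>2
        = (norm (x - a))\<^sup>2 / 2 + (norm (x - b))\<^sup>2 / 2 - (norm (a - b))\<^sup>2 / 4"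
      unfolding power2_norm_eq_inner
      by (simp add: inner_add_left inner_add_right inner_diff_left inner_diff_right
          inner_commute field_simps)
    moreover have "(1/2) *\<^sub>R (a + b) \<in> S"
      using that assms(2) by (intro subspace_scale subspace_add)
    ultimately show ?thesis using m_le[of "(1/2) *\<^sub>R (a + b)"] by argo
  qed
  have "Cauchy X"
  proof (rule metric_CauchyI)
    fix e :: real assume "0 < e"
    then obtain k where k: "inverse (real (Suc k)) < e\<^sup>2 / 4"
      using reals_Archimedean[of "e\<^sup>2 / 4"] by auto
    have *: "(norm (x - X i))\<^sup>2 - m < e\<^sup>2 / 4" if "i \<ge> k" for i
    proof -
      have "1 / real (Suc i) \<le> inverse (real (Suc k))"
        using that by (simp add: field_simps)
      with X(2)[of i] k show ?thesis by linarith
    qed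
    have "dist (X i) (X j) < e" if "i \<ge> k" "j \<ge> k" for i j
    proof -
      have "(norm (X i - X j))\<^sup>2 < e\<^sup>2"
        using mid[OF X(1)[of i] X(1)[of j]] *[OF that(1)] *[OF that(2)] by argo
      then show ?thesis using \<open>0 < e\<close> by (simp add: dist_norm power2_less_imp_less)
    qed
    then show "\<exists>k. \<forall>i\<ge>k. \<forall>j\<ge>k. dist (X i) (X j) < e" by blast
  qed
  then obtain p where p: "X \<longlonglongrightarrow> p" using Cauchy_convergent convergent_def by blast
  have "p \<in> S" using closed_sequentially[OF assms(1)] X(1) p by blast
  have "(\<lambda>n. (norm (x - X n))\<^sup>2) \<longlonglongrightarrow> (norm (x - p))\<^sup>2" by (intro tendsto_intros p)
  moreover have "(\<lambda>n. m + 1 / real (Suc n)) \<longlonglongrightarrow> m + 0"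
    by (intro tendsto_add tendsto_const LIMSEQ_Suc lim_1_over_n)
  ultimately have p_min: "(norm (x - p))\<^sup>2 \<le> m"
    using X(2) by (intro LIMSEQ_le[of _ _ _ m]) (auto intro: less_imp_le)
  have "(x - p) \<bullet> s = 0" if "s \<in> S" for s
  proof (rule ccontr)
    assume nz: "(x - p) \<bullet> s \<noteq> 0"
    define d where "d = (x - p) \<bullet> s"
    have "s \<noteq> 0" using nz by auto
    \<comment> \<open>This value minimizes the quadratic in \<open>t\<close> below; moving from
      \<open>p\<close> to \<open>p + t *\<^sub>R s\<close> lowers the squared distance by
      \<open>d\<^sup>2 / (norm s)\<^sup>2\<close>, against minimality.\<close>
    define t where "t = d / (norm s)\<^sup>2"
    have "(norm (x - (p + t *\<^sub>R s)))\<^sup>2 = (norm (x - p))\<^sup>2 - 2 * t * d + t\<^sup>2 * (norm s)\<^sup>2"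
      unfolding d_def power2_norm_eq_inner
      by (simp add: inner_add_left inner_add_right inner_diff_left inner_diff_right
          inner_commute power2_eq_square algebra_simps)
    also have "\<dots> = (norm (x - p))\<^sup>2 - d\<^sup>2 / (norm s)\<^sup>2"
      using \<open>s \<noteq> 0\<close> by (simp add: t_def field_simps power2_eq_square)
    also have "\<dots> < m" using p_min nz \<open>s \<noteq> 0\<close> unfolding d_def
      by (smt (verit) divide_pos_pos zero_less_power2 norm_eq_zero)
    finally show False
      using m_le[of "p + t *\<^sub>R s"] \<open>p \<in> S\<close> that assms(2)
      by (auto simp: subspace_add subspace_scale)
  qed
  moreover have "x - p \<noteq> 0" using \<open>p \<in> S\<close> assms(3) by auto
  ultimately show ?thesis using that by blast
qed

lemma subspace_closure:
  fixes S :: "'a::real_normed_vector set"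
  assumes "subspace S"
  shows "subspace (closure S)"
  unfolding subspace_def
proof (intro conjI ballI allI)
  show "0 \<in> closure S" using subspace_0[OF assms] closure_subset by blast
  fix x y :: 'a and c :: real
  assume "x \<in> closure S"
  then obtain X where X: "\<And>n. X n \<in> S" "X \<longlonglongrightarrow> x" unfolding closure_sequential by blast
  show "c *\<^sub>R x \<in> closure S"
    unfolding closure_sequential using X assms
    by (intro exI[of _ "\<lambda>n. c *\<^sub>R X n"]) (auto intro!: subspace_scale tendsto_intros)
  assume "y \<in> closure S"
  then obtain Y where "\<And>n. Y n \<in> S" "Y \<longlonglongrightarrow> y" unfolding closure_sequential by blast
  with X show "x + y \<in> closure S"
    unfolding closure_sequential using assms
    by (intro exI[of _ "\<lambda>n. X n + Y n"]) (auto intro!: subspace_add tendsto_intros)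
qed

text \<open>Zorn's lemma gives a maximal orthonormal set above \<open>E\<close>. If its span were
  not dense, a unit vector orthogonal to the closed span would enlarge it.\<close>

lemma orthonormal_extend_basis:
  fixes E :: "'a::{real_inner, complete_space} set"
  assumes "orthonormal E"
  obtains B where "E \<subseteq> B" "orthonormal_basis B"
proof -
  let ?A = "{B. E \<subseteq> B \<and> orthonormal B}"
  have "\<exists>M\<in>?A. \<forall>X\<in>?A. M \<subseteq> X \<longrightarrow> X = M"
  proof (rule subset_Zorn_nonempty)
    show "?A \<noteq> {}" using assms by blast
    fix \<C> assume "\<C> \<noteq> {}" and ch: "subset.chain ?A \<C>"
    then have C: "\<And>X. X \<in> \<C> \<Longrightarrow> E \<subseteq> X \<and> orthonormal X" by (auto simp: subset.chain_def)
    have "orthonormal (\<Union>\<C>)"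
      unfolding orthonormal_def pairwise_def
    proof (intro conjI ballI impI)
      fix x y assume "x \<in> \<Union>\<C>" "y \<in> \<Union>\<C>" "x \<noteq> y"
      then obtain X Y where XY: "X \<in> \<C>" "Y \<in> \<C>" "x \<in> X" "y \<in> Y" by blast
      then have "X \<subseteq> Y \<or> Y \<subseteq> X" using ch unfolding subset_chain_def by blast
      then obtain Z where "Z \<in> \<C>" "x \<in> Z" "y \<in> Z" using XY by blast
      then show "orthogonal x y" using C \<open>x \<noteq> y\<close> unfolding orthonormal_def pairwise_def by blast
    next
      fix e assume "e \<in> \<Union>\<C>"
      then show "norm e = 1" using C unfolding orthonormal_def by blast
    qed
    then show "\<Union>\<C> \<in> ?A" using C \<open>\<C> \<noteq> {}\<close> by blast
  qed
  then obtain B where "B \<in> ?A" and max': "\<forall>X\<in>?A. B \<subseteq> X \<longrightarrow> X = B" by (rule bexE)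
  then have B: "E \<subseteq> B" "orthonormal B" by simp_all
  have max: "X = B" if "orthonormal X" "B \<subseteq> X" for X
    using max' that B(1) by simp
  have "closure (span B) = UNIV"
  proof (rule ccontr)
    assume "closure (span B) \<noteq> UNIV"
    then obtain x where "x \<notin> closure (span B)" by blast
    then obtain y where y: "y \<noteq> 0" "\<And>s. s \<in> closure (span B) \<Longrightarrow> y \<bullet> s = 0"
      using closed_subspace_orthogonal_vector[OF closed_closure subspace_closure[OF subspace_span]]
      by metis
    have yB: "y \<bullet> e = 0" if "e \<in> B" for e
      using y(2) closure_subset span_base that by blast
    have "orthonormal (insert (sgn y) B)"
      using B(2) y(1) yB
      by (auto simp: orthonormal_def pairwise_insert orthogonal_def sgn_div_norm inner_commute)
    then have "sgn y \<in> B" using max[of "insert (sgn y) B"] by blast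
    then have "y \<bullet> sgn y = 0" using yB by blast
    then show False using y(1) by (simp add: sgn_div_norm)
  qed
  with B that show ?thesis by (auto simp: orthonormal_basis_def)
qed

text \<open>The open mapping argument is run inside the closed subspaces \<open>T\<close> and \<open>f ` T\<close>, since these
  are not types to which a theorem about Banach spaces could be applied.\<close>

lemma closed_range_bounded_below:
  fixes f :: "'a::banach \<Rightarrow> 'b::banach"
  assumes f: "bounded_linear f" and T: "subspace T" "closed T"
    and inj: "inj_on f T" and cl: "closed (f ` T)"
  obtains K where "K \<ge> 0" "\<And>x. x \<in> T \<Longrightarrow> norm x \<le> K * norm (f x)"
proof -
  interpret f: bounded_linear f by fact
  define Y where "Y = f ` T"
  \<comment> \<open>These closed sets cover \<open>Y\<close>, which is complete as a closed set, so
    by Baire one of them has interior relative to \<open>Y\<close>.\<close>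
  define C where "C n = closure (f ` (T \<inter> cball 0 (real n)))" for n
  have "C n \<subseteq> Y" for n
    unfolding C_def Y_def by (rule closure_minimal[OF _ cl]) auto
  have "Y \<subseteq> (\<Union>n. C n)"
  proof
    fix y assume "y \<in> Y"
    then obtain x where x: "x \<in> T" "y = f x" by (auto simp: Y_def)
    obtain n where "norm x \<le> real n" using real_arch_simple by blast
    then have "y \<in> C n" using x closure_subset by (force simp: C_def)
    then show "y \<in> (\<Union>n. C n)" by blast
  qed
  then have Y_eq: "(\<Union>n. C n) = Y" using \<open>\<And>n. C n \<subseteq> Y\<close> by blast
  have "\<exists>n. top_of_set Y interior_of C n \<noteq> {}"
  proof (rule ccontr)
    assume "\<not> ?thesis"
    moreover have "completely_metrizable_space (top_of_set Y)"
      using cl by (intro completely_metrizable_space_closedin completely_metrizable_space_euclidean)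
        (simp add: Y_def)
    moreover have "closedin (top_of_set Y) (C n)" for n
      using \<open>C n \<subseteq> Y\<close> by (intro closed_subset) (simp_all add: C_def)
    ultimately have "top_of_set Y interior_of (\<Union>(range C)) = {}"
      by (intro Baire_category_alt) auto
    then have "Y = {}" using interior_of_topspace[of "top_of_set Y"] by (simp add: Y_eq)
    then show False using subspace_0[OF T(1)] by (auto simp: Y_def)
  qed
  then obtain n y U where U: "openin (top_of_set Y) U" "y \<in> U" "U \<subseteq> C n"
    by (auto simp: interior_of_def)
  then obtain r where "r > 0" and r: "\<And>w. w \<in> Y \<Longrightarrow> dist w y < r \<Longrightarrow> w \<in> C n" and "y \<in> Y"
    unfolding openin_euclidean_subtopology_iff by (metis subsetD)
  have Ysub: "subspace Y" unfolding Y_def by (rule linear_subspace_image[OF _ T(1)]) (rule f.linear)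
  \<comment> \<open>Both \<open>y\<close> and \<open>y + w\<close> lie in \<open>C n\<close>;
    subtracting their approximate preimages gives one for \<open>w\<close>. This moves the ball from
    \<open>y\<close> to the origin and doubles the bound \<open>n\<close>.\<close>
  have near: "\<exists>t\<in>T. norm t \<le> 2 * real n \<and> norm (w - f t) < e"
    if "w \<in> Y" "norm w < r" "e > 0" for w e
  proof -
    have "y + w \<in> C n" using that \<open>y \<in> Y\<close> Ysub by (intro r) (auto simp: subspace_add dist_norm)
    moreover have "y \<in> C n" using \<open>y \<in> Y\<close> \<open>r > 0\<close> by (intro r) auto
    ultimately obtain a b where ab: "a \<in> T" "norm a \<le> n" "dist (f a) (y + w) < e/2"
        "b \<in> T" "norm b \<le> n" "dist (f b) y < e/2"
      using \<open>e > 0\<close> unfolding C_def closure_approachable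
      by (auto dest!: spec[of _ "e/2"])
    have "norm (w - f (a - b)) = norm ((f b - y) - (f a - (y + w)))"
      by (simp add: f.diff algebra_simps)
    also have "\<dots> < e"
      using norm_triangle_ineq4[of "f b - y" "f a - (y + w)"] ab by (simp add: dist_norm)
    finally show ?thesis
      using ab norm_triangle_ineq4[of a b] T(1) by (intro bexI[of _ "a - b"]) (auto simp: subspace_diff)
  qed
  \<comment> \<open>The factor comes from rescaling \<open>w\<close> to norm \<open>r / 2\<close>:
    the bound \<open>2 * real n\<close> is then divided by \<open>r / (2 * norm w)\<close>.\<close>
  define L where "L = 4 * real n / r"
  have "L \<ge> 0" using \<open>r > 0\<close> by (simp add: L_def)
  have step: "\<exists>t. t \<in> T \<and> norm t \<le> L * norm w \<and> norm (w - f t) \<le> norm w / 2" if "w \<in> Y" for w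
  proof (cases "w = 0")
    case True
    then show ?thesis using subspace_0[OF T(1)] by (intro exI[of _ 0]) auto
  next
    case False
    define s where "s = r / (2 * norm w)"
    have "s > 0" using False \<open>r > 0\<close> by (simp add: s_def)
    have "s *\<^sub>R w \<in> Y" using that Ysub by (simp add: subspace_scale)
    moreover have "norm (s *\<^sub>R w) < r" using False \<open>r > 0\<close> by (simp add: s_def)
    ultimately obtain t where t: "t \<in> T" "norm t \<le> 2 * real n" "norm (s *\<^sub>R w - f t) < s * norm w / 2"
      using near[of "s *\<^sub>R w" "s * norm w / 2"] False \<open>s > 0\<close> by auto
    have "norm (w - f ((1/s) *\<^sub>R t)) = norm (s *\<^sub>R w - f t) / s"
    proof -
      have "w - f ((1/s) *\<^sub>R t) = (1/s) *\<^sub>R (s *\<^sub>R w - f t)"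
        using \<open>s > 0\<close> by (simp add: f.scaleR scaleR_diff_right)
      then show ?thesis using \<open>s > 0\<close> by simp
    qed
    also have "\<dots> \<le> norm w / 2" using t(3) \<open>s > 0\<close> by (simp add: field_simps)
    finally have "norm (w - f ((1/s) *\<^sub>R t)) \<le> norm w / 2" .
    moreover have "norm ((1/s) *\<^sub>R t) \<le> L * norm w"
      using t(2) \<open>s > 0\<close> \<open>r > 0\<close> False by (simp add: L_def s_def field_simps)
    ultimately show ?thesis using t(1) T(1) by (intro exI[of _ "(1/s) *\<^sub>R t"]) (auto simp: subspace_scale)
  qed
  then obtain h where h: "\<And>w. w \<in> Y \<Longrightarrow> h w \<in> T" "\<And>w. w \<in> Y \<Longrightarrow> norm (h w) \<le> L * norm w"
      "\<And>w. w \<in> Y \<Longrightarrow> norm (w - f (h w)) \<le> norm w / 2" by metis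
  have "norm x \<le> 2 * L * norm (f x)" if "x \<in> T" for x
  proof -
    \<comment> \<open>\<open>w k\<close> is the residual after \<open>k\<close> corrections. Its
      norm at least halves at each step, so the corrections sum to some \<open>t\<close> in
      \<open>T\<close> with \<open>f t = f x\<close>, and injectivity identifies \<open>t\<close>
      with \<open>x\<close>. The geometric series yields the factor 2.\<close>
    define w where "w k = ((\<lambda>w. w - f (h w)) ^^ k) (f x)" for k
    have w0: "w 0 = f x" and wSuc: "w (Suc k) = w k - f (h (w k))" for k by (simp_all add: w_def)
    have wY: "w k \<in> Y" for k
      by (induction k) (use that h(1) Ysub in \<open>auto simp: w0 wSuc Y_def intro!: subspace_diff\<close>)
    have wn: "norm (w k) \<le> norm (f x) * (1/2) ^ k" for k
    proof (induction k)
      case (Suc k)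
      then show ?case using h(3)[OF wY[of k]] by (simp add: wSuc)
    qed (simp add: w0)
    have hn: "norm (h (w k)) \<le> L * norm (f x) * (1/2) ^ k" for k
      using h(2)[OF wY[of k]] mult_left_mono[OF wn[of k] \<open>L \<ge> 0\<close>] by (simp add: mult.assoc)
    have geo: "(\<lambda>k. L * norm (f x) * (1/2) ^ k) sums (L * norm (f x) * 2)"
      using sums_mult[OF geometric_sums[of "1/2::real"]] by simp
    have sm: "summable (\<lambda>k. h (w k))"
      by (rule summable_comparison_test'[OF sums_summable[OF geo]]) (use hn in auto)
    define t where "t = (\<Sum>k. h (w k))"
    have lim: "(\<lambda>n. \<Sum>k<n. h (w k)) \<longlonglongrightarrow> t" using summable_LIMSEQ[OF sm] by (simp add: t_def)
    have "(\<Sum>k<n. h (w k)) \<in> T" for n using h(1) wY T(1) by (intro subspace_sum) auto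
    then have "t \<in> T" by (rule closed_sequentially[OF T(2) _ lim])
    have "f (\<Sum>k<n. h (w k)) = f x - w n" for n
      by (induction n) (auto simp: w0 wSuc f.zero f.add)
    moreover have "w \<longlonglongrightarrow> 0"
      by (rule Lim_null_comparison[of _ "\<lambda>k. norm (f x) * (1/2) ^ k"])
        (use wn in \<open>auto intro!: tendsto_mult_right_zero LIMSEQ_realpow_zero\<close>)
    then have "(\<lambda>n. f x - w n) \<longlonglongrightarrow> f x - 0" by (intro tendsto_intros)
    ultimately have "f t = f x" using LIMSEQ_unique[OF f.tendsto[OF lim]] by simp
    then have "t = x" using inj \<open>t \<in> T\<close> that by (auto dest: inj_onD)
    moreover have "norm t \<le> L * norm (f x) * 2"
      unfolding t_def using norm_suminf_le[OF hn sums_summable[OF geo]] sums_unique[OF geo] by simp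
    ultimately show ?thesis by (simp add: mult_ac)
  qed
  then show ?thesis using that[of "2 * L"] \<open>L \<ge> 0\<close> by auto
qed

subsection \<open>Singular value decomposition of Hilbert--Schmidt operators\<close>

lemma bounded_linear_adjoint_hilbert:
  fixes f :: "'a::{real_inner, complete_space} \<Rightarrow> 'b::real_inner"
  assumes f: "bounded_linear f"
  shows "bounded_linear (adjoint f)"
proof (rule bounded_linear_intro)
  note adj = adjoint_works_hilbert[OF f, symmetric]
  show "adjoint f (x + y) = adjoint f x + adjoint f y" for x y
    by (rule vector_eq_ldot[THEN iffD1]) (simp add: adj inner_add_right)
  show "adjoint f (r *\<^sub>R x) = r *\<^sub>R adjoint f x" for r x
    by (rule vector_eq_ldot[THEN iffD1]) (simp add: adj)
  show "norm (adjoint f y) \<le> norm y * onorm f" for y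
  proof (cases "adjoint f y = 0")
    case False
    have "(norm (adjoint f y))\<^sup>2 = f (adjoint f y) \<bullet> y"
      by (simp add: power2_norm_eq_inner adj)
    also have "\<dots> \<le> norm (f (adjoint f y)) * norm y" by (rule norm_cauchy_schwarz)
    also have "\<dots> \<le> (onorm f * norm (adjoint f y)) * norm y"
      by (intro mult_right_mono onorm f) auto
    finally have "norm (adjoint f y) * norm (adjoint f y) \<le> norm (adjoint f y) * (norm y * onorm f)"
      by (simp add: power2_eq_square mult_ac)
    then show ?thesis using False by simp
  qed (simp add: onorm_pos_le[OF f])
qed

lemma hs_adjoint: "hs_apply G x \<bullet> y = x \<bullet> adjoint (hs_apply G) y"
  by (rule adjoint_works_hilbert) (rule blinfun.bounded_linear_right)

lemma norm_hs_apply_le: "norm (hs_apply G x) \<le> norm G * norm x"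
  by (rule order_trans[OF norm_blinfun mult_right_mono]) (auto simp: norm_blinfun_of_hs_le)

lemma bounded_linear_hs_apply: "bounded_linear (\<lambda>G. hs_apply G x)"
  by (rule bounded_linear_intro[of _ "norm x"])
    (simp_all add: plus_hs.rep_eq scaleR_hs.rep_eq blinfun.add_left blinfun.scaleR_left norm_hs_apply_le)

lemmas hs_apply_add = linear_add[OF bounded_linear.linear[OF bounded_linear_hs_apply]]
lemmas hs_apply_diff = linear_diff[OF bounded_linear.linear[OF bounded_linear_hs_apply]]
lemmas hs_apply_scaleR = linear_scale[OF bounded_linear.linear[OF bounded_linear_hs_apply]]
lemmas hs_apply_sum = linear_sum[OF bounded_linear.linear[OF bounded_linear_hs_apply]]

text \<open>In an orthonormal basis containing \<open>sgn u\<close> every term but that of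
  \<open>sgn u\<close> vanishes; \<open>inner_hs_eq\<close> permits the change of basis.\<close>

lemma inner_hs_tensor_right: "inner G (u \<otimes> a) = hs_apply G u \<bullet> a"
proof (cases "u = 0")
  case True
  then have "u \<otimes> a = 0" by (intro hs_eqI) (simp add: hs_tensor_apply zero_hs.rep_eq)
  then show ?thesis using True by (simp add: blinfun.zero_right)
next
  case False
  have "orthonormal {sgn u}" using False by (simp add: orthonormal_def norm_sgn)
  then obtain B where B: "{sgn u} \<subseteq> B" "orthonormal_basis B" by (rule orthonormal_extend_basis)
  have u: "u = norm u *\<^sub>R sgn u" using False by (simp add: sgn_div_norm)
  have *: "u \<bullet> e = (if e = sgn u then norm u else 0)" if "e \<in> B" for e
    using orthonormal_inner[of B "sgn u" e] B that
    by (subst u) (auto simp: orthonormal_basis_def)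
  have "inner G (u \<otimes> a) = (\<Sum>\<^sub>\<infinity>e\<in>{sgn u}. hs_apply G e \<bullet> hs_apply (u \<otimes> a) e)"
    unfolding inner_hs_eq[OF B(2)]
    by (rule infsum_cong_neutral) (use B(1) * in \<open>auto simp: hs_tensor_apply\<close>)
  also have "\<dots> = hs_apply G (norm u *\<^sub>R sgn u) \<bullet> a"
    using *[of "sgn u"] B(1) by (simp add: hs_tensor_apply blinfun.scaleR_right)
  finally show ?thesis using u by simp
qed

text \<open>Pythagoras: the sum is \<open>G\<close> composed with the projection onto the span of
  \<open>F\<close>, and its pairings with itself and with \<open>G\<close> agree. It serves both the
  finite-rank approximation of \<open>G\<close> and the bound on multiplicities.\<close>

lemma norm_hs_truncate:
  assumes "orthonormal F" "finite F"
  shows "(norm (G - (\<Sum>e\<in>F. e \<otimes> hs_apply G e)))\<^sup>2 = (norm G)\<^sup>2 - (\<Sum>e\<in>F. (norm (hs_apply G e))\<^sup>2)"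
proof -
  let ?P = "\<Sum>e\<in>F. e \<otimes> hs_apply G e"
  have P: "hs_apply ?P e = hs_apply G e" if "e \<in> F" for e
  proof -
    have "hs_apply ?P e = (\<Sum>e'\<in>F. if e' = e then hs_apply G e' else 0)"
      unfolding hs_apply_sum hs_tensor_apply
      by (rule sum.cong) (use orthonormal_inner[OF assms(1)] that in auto)
    then show ?thesis using that assms(2) by simp
  qed
  have "inner ?P ?P = (\<Sum>e\<in>F. (norm (hs_apply G e))\<^sup>2)"
    by (simp only: inner_sum_right inner_hs_tensor_right)
      (simp add: P power2_norm_eq_inner cong: sum.cong)
  moreover have "inner G ?P = (\<Sum>e\<in>F. (norm (hs_apply G e))\<^sup>2)"
    by (simp add: inner_sum_right inner_hs_tensor_right power2_norm_eq_inner)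
  ultimately show ?thesis
    by (simp add: power2_norm_eq_inner inner_diff_left inner_diff_right inner_commute[of ?P G])
qed

lemma orthonormal_subset: "orthonormal B \<Longrightarrow> F \<subseteq> B \<Longrightarrow> orthonormal F"
  unfolding orthonormal_def pairwise_def by blast

text \<open>The set is a Minkowski sum of segments. It will contain the image of the unit ball under
  a finite-rank truncation.\<close>

lemma bounded_combinations_in_compact:
  fixes g :: "'i \<Rightarrow> 'b::real_normed_vector"
  assumes "finite F"
  shows "\<exists>S. compact S \<and> (\<forall>c. (\<forall>e\<in>F. \<bar>c e\<bar> \<le> 1) \<longrightarrow> (\<Sum>e\<in>F. c e *\<^sub>R g e) \<in> S)"
  using assms
proof (induction F)
  case empty
  show ?case by (intro exI[of _ "{0}"]) auto
next
  case (insert a F)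
  then obtain S where S: "compact S" "\<And>c. (\<forall>e\<in>F. \<bar>c e\<bar> \<le> 1) \<Longrightarrow> (\<Sum>e\<in>F. c e *\<^sub>R g e) \<in> S"
    by blast
  have "compact ((\<lambda>t. t *\<^sub>R g a) ` {-1..1::real})"
    by (intro compact_continuous_image continuous_intros) auto
  from compact_sums'[OF this S(1)] show ?case
    by (rule_tac exI, rule_tac conjI, assumption)
      (use insert S(2) in \<open>force simp: abs_le_iff\<close>)
qed

text \<open>\<open>G\<close> is within \<epsilon>/4 of a finite-rank operator in Hilbert--Schmidt
  norm, hence in operator norm. The finite net for the finite-rank image, the truncation and the
  passage to the closure cost \<epsilon>/4 each.\<close>

lemma hs_compact: "compact (closure (hs_apply G ` cball 0 1))"
  unfolding compact_eq_totally_bounded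
proof (intro conjI allI impI)
  show "complete (closure (hs_apply G ` cball 0 1))" by (simp add: complete_eq_closed)
  fix \<epsilon> :: real assume "0 < \<epsilon>"
  have sm: "(\<lambda>e. (norm (hs_apply G e))\<^sup>2) summable_on some_onb"
    using hilbert_schmidt_hs_apply[of G] by (simp add: hilbert_schmidt_def)
  obtain F where F: "finite F" "F \<subseteq> some_onb"
      "dist (\<Sum>e\<in>F. (norm (hs_apply G e))\<^sup>2) ((norm G)\<^sup>2) \<le> (\<epsilon>/4)\<^sup>2"
    using infsum_finite_approximation[OF sm, of "(\<epsilon>/4)\<^sup>2"] \<open>0 < \<epsilon>\<close>
    unfolding norm_hs_sq[OF orthonormal_basis_some_onb] by auto
  have "orthonormal F"
    using F(2) orthonormal_basis_some_onb unfolding orthonormal_basis_def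
    by (blast intro: orthonormal_subset)
  define R where "R = G - (\<Sum>e\<in>F. e \<otimes> hs_apply G e)"
  have "(norm R)\<^sup>2 \<le> (\<epsilon>/4)\<^sup>2"
    using F(3) unfolding R_def norm_hs_truncate[OF \<open>orthonormal F\<close> F(1)] dist_real_def by linarith
  then have R: "norm R \<le> \<epsilon>/4" by (rule power2_le_imp_le) (use \<open>0 < \<epsilon>\<close> in simp)
  obtain S where S: "compact S"
      "\<And>c. (\<forall>e\<in>F. \<bar>c e\<bar> \<le> 1) \<Longrightarrow> (\<Sum>e\<in>F. c e *\<^sub>R hs_apply G e) \<in> S"
    using bounded_combinations_in_compact[OF F(1)] by blast
  obtain k where k: "finite k" "S \<subseteq> (\<Union>x\<in>k. ball x (\<epsilon>/4))"
    using compact_eq_totally_bounded[THEN iffD1, OF S(1)] \<open>0 < \<epsilon>\<close> by (auto dest!: spec[of _ "\<epsilon>/4"])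
  have "closure (hs_apply G ` cball 0 1) \<subseteq> (\<Union>x\<in>k. ball x \<epsilon>)"
  proof
    fix y assume "y \<in> closure (hs_apply G ` cball 0 1)"
    then obtain x where x: "norm x \<le> 1" "dist (hs_apply G x) y < \<epsilon>/4"
      using \<open>0 < \<epsilon>\<close> unfolding closure_approachable by (auto dest!: spec[of _ "\<epsilon>/4"])
    let ?p = "\<Sum>e\<in>F. (e \<bullet> x) *\<^sub>R hs_apply G e"
    have "\<bar>e \<bullet> x\<bar> \<le> 1" if "e \<in> F" for e
      using Cauchy_Schwarz_ineq2[of e x] that x(1) \<open>orthonormal F\<close> by (auto simp: orthonormal_def)
    then have "?p \<in> S" using S(2)[of "\<lambda>e. e \<bullet> x"] by simp
    then obtain q where q: "q \<in> k" "dist q ?p < \<epsilon>/4" using k(2) by auto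
    have "hs_apply G x - ?p = hs_apply R x"
      by (simp add: R_def hs_apply_diff hs_apply_sum hs_tensor_apply)
    also have "norm \<dots> \<le> \<epsilon>/4"
      using norm_hs_apply_le[of R x] mult_mono[OF R x(1)] \<open>0 < \<epsilon>\<close> by simp
    finally have "dist ?p (hs_apply G x) \<le> \<epsilon>/4" by (simp add: dist_norm norm_minus_commute)
    moreover have "dist q y \<le> dist q ?p + dist ?p (hs_apply G x) + dist (hs_apply G x) y"
      using dist_triangle[of q y ?p] dist_triangle[of ?p y "hs_apply G x"] by linarith
    ultimately have "dist q y < \<epsilon>" using q(2) x(2) \<open>0 < \<epsilon>\<close> by linarith
    then show "y \<in> (\<Union>x\<in>k. ball x \<epsilon>)" using q(1) by auto
  qed
  then show "\<exists>k. finite k \<and> closure (hs_apply G ` cball 0 1) \<subseteq> (\<Union>x\<in>k. ball x \<epsilon>)"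
    using k(1) by blast
qed

lemma subspace_singular_space: "subspace (singular_space G s)"
proof -
  interpret A: bounded_linear "adjoint (hs_apply G)"
    by (intro bounded_linear_adjoint_hilbert blinfun.bounded_linear_right)
  show ?thesis
    by (auto simp: subspace_def singular_space_def blinfun.zero_right blinfun.add_right
        blinfun.scaleR_right A.zero A.add A.scaleR scaleR_add_right)
qed

lemma norm_apply_singular_space:
  assumes "x \<in> singular_space G s" "s \<ge> 0"
  shows "norm (hs_apply G x) = s * norm x"
proof -
  have "(norm (hs_apply G x))\<^sup>2 = (s * norm x)\<^sup>2"
    using assms(1) by (simp add: power2_norm_eq_inner hs_adjoint singular_space_def power_mult_distrib)
  then show ?thesis using assms(2) by (simp add: power2_eq_iff_nonneg)
qed

text \<open>Moving \<open>G\<close> across the inner product from either side evaluates the pairing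
  of \<open>G x\<close> with \<open>G y\<close> both as s^2 and as t^2 times
  \<open>x \<bullet> y\<close>.\<close>

lemma singular_spaces_orthogonal:
  assumes "x \<in> singular_space G s" "y \<in> singular_space G t" "s > 0" "t > 0" "s \<noteq> t"
  shows "x \<bullet> y = 0"
proof -
  have "t\<^sup>2 * (x \<bullet> y) = hs_apply G x \<bullet> hs_apply G y"
    using assms(2) by (simp add: hs_adjoint singular_space_def)
  also have "\<dots> = s\<^sup>2 * (x \<bullet> y)"
    using assms(1) unfolding inner_commute[of "hs_apply G x"] hs_adjoint[of G y]
    by (simp add: singular_space_def inner_commute)
  finally show ?thesis using assms(3-5) by (simp add: power2_eq_iff_nonneg)
qed

lemma orthonormal_independent: "orthonormal E \<Longrightarrow> independent E"
  by (rule pairwise_orthogonal_independent) (auto simp: orthonormal_def)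

text \<open>Each vector of an orthonormal subset contributes \<open>s\<^sup>2\<close> to the squared
  Hilbert--Schmidt norm, so such subsets have at most \<open>(norm G)\<^sup>2 / s\<^sup>2\<close>
  elements, and a largest one spans. Finiteness matters because \<open>dim\<close> is 0 on
  infinite-dimensional spaces.\<close>

lemma singular_space_basis:
  assumes "s > 0"
  obtains E where "finite E" "orthonormal E" "span E = singular_space G s"
    "card E = dim (singular_space G s)"
proof -
  let ?V = "singular_space G s"
  let ?P = "\<lambda>k. \<exists>E. finite E \<and> orthonormal E \<and> E \<subseteq> ?V \<and> card E = k"
  have bound: "k \<le> nat \<lfloor>(norm G)\<^sup>2 / s\<^sup>2\<rfloor>" if "?P k" for k
  proof -
    from that obtain E where E: "finite E" "orthonormal E" "E \<subseteq> ?V" "card E = k" by blast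
    have "(norm (hs_apply G e))\<^sup>2 = s\<^sup>2" if "e \<in> E" for e
      using norm_apply_singular_space[of e G s] E that assms by (auto simp: orthonormal_def)
    then have "real k * s\<^sup>2 = (\<Sum>e\<in>E. (norm (hs_apply G e))\<^sup>2)" using E(4) by simp
    also have "\<dots> \<le> (norm G)\<^sup>2"
      by (subst diff_ge_0_iff_ge[symmetric], subst norm_hs_truncate[OF E(2,1), symmetric]) (rule zero_le_power2)
    finally show ?thesis using assms by (simp add: le_nat_floor field_simps)
  qed
  have "?P 0" by (intro exI[of _ "{}"]) (auto simp: orthonormal_def)
  then have "?P (Greatest ?P)"
    by (rule GreatestI_nat[where P = ?P and b = "nat \<lfloor>(norm G)\<^sup>2 / s\<^sup>2\<rfloor>"]) (rule bound)
  then obtain E where E: "finite E" "orthonormal E" "E \<subseteq> ?V" "card E = Greatest ?P" by (elim exE conjE)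
  have "?V \<subseteq> span E"
  proof
    fix x assume "x \<in> ?V"
    show "x \<in> span E"
    proof (rule ccontr)
      assume "x \<notin> span E"
      \<comment> \<open>Gram--Schmidt: the component of \<open>x\<close> orthogonal to
        \<open>E\<close>, normalized, would extend \<open>E\<close> beyond the largest
        cardinality.\<close>
      define y where "y = x - (\<Sum>e\<in>E. (x \<bullet> e) *\<^sub>R e)"
      have sumE: "(\<Sum>e\<in>E. (x \<bullet> e) *\<^sub>R e) \<in> span E" by (intro span_sum span_scale span_base)
      then have "y \<noteq> 0" using \<open>x \<notin> span E\<close> by (auto simp: y_def)
      have spanV: "span E \<subseteq> ?V" using E(3) subspace_singular_space by (rule span_minimal)
      then have "y \<in> ?V"
        unfolding y_def using sumE \<open>x \<in> ?V\<close> by (intro subspace_diff subspace_singular_space) auto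
      have yE: "y \<bullet> e = 0" if "e \<in> E" for e
      proof -
        have "(\<Sum>e'\<in>E. (x \<bullet> e') *\<^sub>R e') \<bullet> e = (\<Sum>e'\<in>E. if e' = e then x \<bullet> e' else 0)"
          unfolding inner_sum_left
          by (rule sum.cong) (use orthonormal_inner[OF E(2)] that in auto)
        then show ?thesis using that E(1) by (simp add: y_def inner_diff_left)
      qed
      have "sgn y \<notin> E" using yE \<open>y \<noteq> 0\<close> by (force simp: sgn_div_norm)
      have "orthonormal (insert (sgn y) E)"
        using E(2) \<open>y \<noteq> 0\<close> yE
        by (auto simp: orthonormal_def pairwise_insert orthogonal_def sgn_div_norm inner_commute)
      moreover have "sgn y \<in> ?V"
        using \<open>y \<in> ?V\<close> by (simp add: sgn_div_norm subspace_scale subspace_singular_space)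
      ultimately have "?P (Suc (Greatest ?P))"
        using E \<open>sgn y \<notin> E\<close> by (intro exI[of _ "insert (sgn y) E"]) auto
      then have "Suc (Greatest ?P) \<le> Greatest ?P" by (rule Greatest_le_nat) (rule bound)
      then show False by simp
    qed
  qed
  moreover have "span E \<subseteq> ?V" using E(3) subspace_singular_space by (rule span_minimal)
  ultimately show ?thesis
    using that[OF E(1,2)] dim_unique[OF E(3) _ orthonormal_independent[OF E(2)] refl] by simp
qed

text \<open>With \<open>\<mu>\<close> the supremum of \<open>\<parallel>G x\<parallel>\<^sup>2\<close> over the unit ball of \<open>N\<close>, a maximizing sequence \<open>X\<close>
  satisfies \<open>G\<^sup>* G X - \<mu> X \<longlonglongrightarrow> 0\<close>; compactness of \<open>G\<close> then makes a subsequence converge to an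
  eigenvector.\<close>

lemma singular_vector_exists:
  assumes N: "closed N" "subspace N"
    and inv: "\<And>x. x \<in> N \<Longrightarrow> adjoint (hs_apply G) (hs_apply G x) \<in> N"
    and x0: "x0 \<in> N" "hs_apply G x0 \<noteq> 0"
  obtains s x where "s > 0" "x \<in> N" "x \<noteq> 0" "x \<in> singular_space G s"
proof -
  let ?G = "hs_apply G" and ?A = "adjoint (hs_apply G)"
  interpret A: bounded_linear ?A
    by (intro bounded_linear_adjoint_hilbert blinfun.bounded_linear_right)
  define D where "D = N \<inter> cball 0 1"
  define \<mu> where "\<mu> = (SUP x\<in>D. (norm (?G x))\<^sup>2)"
  have "(norm (?G x))\<^sup>2 \<le> (norm G)\<^sup>2" if "x \<in> D" for x
    using norm_hs_apply_le[of G x] that mult_left_mono[of "norm x" 1 "norm G"]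
    by (intro power_mono) (auto simp: D_def)
  then have bdd: "bdd_above ((\<lambda>x. (norm (?G x))\<^sup>2) ` D)" by (rule bdd_aboveI2)
  have "D \<noteq> {}" using subspace_0[OF N(2)] by (auto simp: D_def)
  have bound: "(norm (?G x))\<^sup>2 \<le> \<mu> * (norm x)\<^sup>2" if "x \<in> N" for x
  proof (cases "x = 0")
    case False
    have "sgn x \<in> D" using that N(2) False by (simp add: D_def sgn_div_norm subspace_scale)
    then have "(norm (?G (sgn x)))\<^sup>2 \<le> \<mu>" unfolding \<mu>_def using bdd by (rule cSUP_upper)
    then show ?thesis
      using False by (simp add: sgn_div_norm blinfun.scaleR_right power_mult_distrib field_simps)
  qed (simp add: blinfun.zero_right)
  have "\<mu> > 0"
    using bound[OF x0(1)] x0(2)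
    by (metis less_le_trans mult_eq_0_iff norm_eq_zero not_less zero_less_mult_pos2 zero_less_norm_iff
        zero_less_power2 zero_le_power2 mult_nonpos_nonneg)
  have "\<exists>x\<in>D. \<mu> - 1 / real (Suc n) < (norm (?G x))\<^sup>2" for n
    using less_cSUP_iff[OF \<open>D \<noteq> {}\<close> bdd, of "\<mu> - 1 / real (Suc n)"] by (auto simp: \<mu>_def)
  then obtain X where X: "\<And>n. X n \<in> D" "\<And>n. \<mu> - 1 / real (Suc n) < (norm (?G (X n)))\<^sup>2"
    by metis
  \<comment> \<open>Cauchy--Schwarz, then \<open>bound\<close> at the vector
    \<open>?A (?G x)\<close>, which is again in \<open>N\<close>; one factor of its squared norm
    cancels.\<close>
  have AA: "(norm (?A (?G x)))\<^sup>2 \<le> \<mu> * (norm (?G x))\<^sup>2" if "x \<in> N" for x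
  proof (cases "?A (?G x) = 0")
    case False
    let ?a = "norm (?A (?G x))"
    have "?a\<^sup>2 = ?G (?A (?G x)) \<bullet> ?G x" by (simp add: power2_norm_eq_inner hs_adjoint)
    also have "\<dots> \<le> norm (?G (?A (?G x))) * norm (?G x)" by (rule norm_cauchy_schwarz)
    finally have "(?a\<^sup>2)\<^sup>2 \<le> (norm (?G (?A (?G x))))\<^sup>2 * (norm (?G x))\<^sup>2"
      by (metis power_mono power_mult_distrib zero_le_power2)
    also have "\<dots> \<le> (\<mu> * ?a\<^sup>2) * (norm (?G x))\<^sup>2"
      by (intro mult_right_mono bound inv that) auto
    finally have "?a\<^sup>2 * ?a\<^sup>2 \<le> ?a\<^sup>2 * (\<mu> * (norm (?G x))\<^sup>2)"
      by (simp add: power2_eq_square[of "?a\<^sup>2"] mult_ac)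
    then show ?thesis by (rule mult_left_le_imp_le) (use False in simp)
  qed (use \<open>\<mu> > 0\<close> in simp)
  \<comment> \<open>The cross term of the expanded square is
    \<open>- 2 * \<mu> * (norm (?G (X n)))\<^sup>2\<close>. With \<open>AA\<close> and
    \<open>norm (X n) \<le> 1\<close> at most
    \<open>\<mu> * (\<mu> - (norm (?G (X n)))\<^sup>2)\<close> remains, which is small by the choice
    of \<open>X\<close>.\<close>
  have approx: "(norm (?A (?G (X n)) - \<mu> *\<^sub>R X n))\<^sup>2 \<le> \<mu> * (1 / real (Suc n))" for n
  proof -
    have XN: "X n \<in> N" "(norm (X n))\<^sup>2 \<le> 1"
      using X(1)[of n] by (auto simp: D_def power_le_one)
    have "(norm (?A (?G (X n)) - \<mu> *\<^sub>R X n))\<^sup>2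
        = (norm (?A (?G (X n))))\<^sup>2 - 2 * \<mu> * (X n \<bullet> ?A (?G (X n))) + \<mu>\<^sup>2 * (norm (X n))\<^sup>2"
      unfolding power2_norm_eq_inner
      by (simp add: inner_diff_left inner_diff_right inner_commute power2_eq_square algebra_simps)
    also have "X n \<bullet> ?A (?G (X n)) = (norm (?G (X n)))\<^sup>2"
      by (simp add: hs_adjoint power2_norm_eq_inner)
    also have "(norm (?A (?G (X n))))\<^sup>2 - 2 * \<mu> * (norm (?G (X n)))\<^sup>2 + \<mu>\<^sup>2 * (norm (X n))\<^sup>2
        \<le> \<mu> * (\<mu> - (norm (?G (X n)))\<^sup>2)"
      using AA[OF XN(1)] mult_left_mono[OF XN(2), of "\<mu>\<^sup>2"]
      by (simp add: power2_eq_square[of \<mu>] algebra_simps)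
    also have "\<dots> \<le> \<mu> * (1 / real (Suc n))"
      using X(2)[of n] \<open>\<mu> > 0\<close> by (intro mult_left_mono) auto
    finally show ?thesis .
  qed
  have "?G (X n) \<in> closure (?G ` cball 0 1)" for n
    using X(1)[of n] by (intro subsetD[OF closure_subset]) (auto simp: D_def)
  then obtain y r where r: "strict_mono (r :: nat \<Rightarrow> nat)" and y: "((\<lambda>n. ?G (X n)) \<circ> r) \<longlonglongrightarrow> y"
    using seq_compactE[OF compact_imp_seq_compact[OF hs_compact], of "\<lambda>n. ?G (X n)"] by metis
  have "(\<lambda>n. (norm (?A (?G (X n)) - \<mu> *\<^sub>R X n))\<^sup>2) \<longlonglongrightarrow> 0"
  proof (rule Lim_null_comparison)
    have "(\<lambda>n. \<mu> * (1 / real (Suc n))) \<longlonglongrightarrow> \<mu> * 0"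
      by (intro tendsto_intros LIMSEQ_Suc lim_1_over_n)
    then show "(\<lambda>n. \<mu> * (1 / real (Suc n))) \<longlonglongrightarrow> 0" by (simp only: mult_zero_right)
    show "\<forall>\<^sub>F n in sequentially. norm ((norm (?A (?G (X n)) - \<mu> *\<^sub>R X n))\<^sup>2) \<le> \<mu> * (1 / real (Suc n))"
      by (intro always_eventually allI) (simp only: real_norm_def abs_power2 approx)
  qed
  then have "(\<lambda>n. norm (?A (?G (X n)) - \<mu> *\<^sub>R X n)) \<longlonglongrightarrow> 0"
    by (auto dest: tendsto_real_sqrt)
  then have res: "(\<lambda>n. ?A (?G (X n)) - \<mu> *\<^sub>R X n) \<longlonglongrightarrow> 0" by (rule tendsto_norm_zero_cancel)
  have AX: "(\<lambda>n. ?A (?G (X (r n)))) \<longlonglongrightarrow> ?A y"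
    using A.tendsto[OF y] by (simp add: o_def)
  \<comment> \<open>\<open>X\<close> is recovered as 1/\<mu> times the difference of
    \<open>?A (?G X)\<close> and the residual; both converge along the subsequence, hence so does
    \<open>X\<close>.\<close>
  have "(\<lambda>n. (1/\<mu>) *\<^sub>R (?A (?G (X (r n))) - (?A (?G (X (r n))) - \<mu> *\<^sub>R X (r n)))) \<longlonglongrightarrow> (1/\<mu>) *\<^sub>R (?A y - 0)"
    by (intro tendsto_intros AX LIMSEQ_subseq_LIMSEQ[OF res r, unfolded o_def])
  then have Xlim: "(\<lambda>n. X (r n)) \<longlonglongrightarrow> (1/\<mu>) *\<^sub>R ?A y" using \<open>\<mu> > 0\<close> by simp
  define x where "x = (1/\<mu>) *\<^sub>R ?A y"
  note Xlim = Xlim[folded x_def]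
  have GX: "(\<lambda>n. ?G (X (r n))) \<longlonglongrightarrow> ?G x" by (intro tendsto_intros Xlim)
  have "x \<in> N" using closed_sequentially[OF N(1) _ Xlim] X(1) by (auto simp: D_def)
  have "?A (?G x) = ?A y" using LIMSEQ_unique[OF A.tendsto[OF GX] AX] .
  then have "?A (?G x) = \<mu> *\<^sub>R x" using \<open>\<mu> > 0\<close> by (simp add: x_def)
  then have "x \<in> singular_space G (sqrt \<mu>)" using \<open>\<mu> > 0\<close> by (simp add: singular_space_def)
  \<comment> \<open>Otherwise the values \<open>(norm (?G (X (r n))))\<^sup>2\<close> would tend to
    0, whereas they tend to the supremum \<open>\<mu> > 0\<close>.\<close>
  moreover have "x \<noteq> 0"
  proof
    assume "x = 0"
    then have lim: "(\<lambda>n. (norm (?G (X (r n))))\<^sup>2) \<longlonglongrightarrow> 0"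
      using tendsto_power[OF tendsto_norm[OF GX], of 2] by (simp add: blinfun.zero_right)
    have "(\<lambda>n. \<mu> - 1 / real (Suc (r n))) \<longlonglongrightarrow> \<mu> - 0"
      by (intro tendsto_diff tendsto_const
          LIMSEQ_subseq_LIMSEQ[OF LIMSEQ_Suc[OF lim_1_over_n] r, unfolded o_def])
    then have "\<mu> - 0 \<le> 0"
      using lim by (rule LIMSEQ_le) (use X(2) in \<open>auto intro: less_imp_le\<close>)
    then show False using \<open>\<mu> > 0\<close> by simp
  qed
  ultimately show ?thesis using that[of "sqrt \<mu>" x] \<open>\<mu> > 0\<close> \<open>x \<in> N\<close> by simp
qed

subsection \<open>Duality for the nuclear norm\<close>

lemma sum_le_nuclear_norm:
  assumes "finite S" "S \<subseteq> singular_values G"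
  shows "(\<Sum>s\<in>S. of_nat (dim (singular_space G s)) * ennreal s) \<le> nuclear_norm G"
  unfolding nuclear_norm_def infsum_finite[OF assms(1), symmetric]
  by (rule infsum_mono_neutral) (use assms(2) in \<open>auto intro!: nonneg_summable_on_complete\<close>)

text \<open>The inner product is evaluated in an orthonormal basis made of singular vectors and
  completed by vectors that \<open>G\<close> annihilates. A singular vector for \<open>s\<close>
  contributes at most \<open>s\<close>, and there are \<open>dim (singular_space G s)\<close> of
  them.\<close>

lemma inner_le_nuclear_norm:
  assumes K: "norm (blinfun_of_hs K) \<le> 1"
  shows "ennreal (inner K G) \<le> nuclear_norm G"
proof -
  let ?G = "hs_apply G" and ?K = "hs_apply K"
  have "\<exists>E. s > 0 \<longrightarrow> finite E \<and> orthonormal E \<and> span E = singular_space G s \<and>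
      card E = dim (singular_space G s)" for s
    using singular_space_basis[of s G] by metis
  then obtain E where fin: "\<And>s. s > 0 \<Longrightarrow> finite (E s)" and on: "\<And>s. s > 0 \<Longrightarrow> orthonormal (E s)"
    and span: "\<And>s. s > 0 \<Longrightarrow> span (E s) = singular_space G s"
    and card: "\<And>s. s > 0 \<Longrightarrow> card (E s) = dim (singular_space G s)" by metis
  have Es: "e \<in> singular_space G s" if "e \<in> E s" "s > 0" for e s
    using span[OF that(2)] that(1) span_base by blast
  have Ge: "norm (?G e) = s" if "e \<in> E s" "s > 0" for e s
    using norm_apply_singular_space[OF Es[OF that]] on[OF that(2)] that by (simp add: orthonormal_def)
  define U where "U = (\<Union>s\<in>{0<..}. E s)"
  have "orthonormal U"
    unfolding orthonormal_def pairwise_def orthogonal_def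
  proof (intro conjI ballI impI)
    fix x y assume "x \<in> U" "y \<in> U" "x \<noteq> y"
    then obtain s t where st: "s > 0" "x \<in> E s" "t > 0" "y \<in> E t" by (auto simp: U_def)
    show "x \<bullet> y = 0"
    proof (cases "s = t")
      case True
      then show ?thesis using orthonormal_inner[OF on[OF st(1)] st(2)] st(4) \<open>x \<noteq> y\<close> by simp
    next
      case False
      then show ?thesis using singular_spaces_orthogonal[OF Es Es] st by blast
    qed
  qed (use on in \<open>auto simp: U_def orthonormal_def\<close>)
  then obtain B where B: "U \<subseteq> B" "orthonormal_basis B" by (rule orthonormal_extend_basis)
  define N where "N = {x. \<forall>e\<in>U. x \<bullet> e = 0}"
  \<comment> \<open>\<open>N\<close> is closed and invariant under G^* G. If \<open>G\<close> were
    nonzero on it, \<open>N\<close> would contain a singular vector with \<open>s > 0\<close>; but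
    that vector lies in the span of \<open>E s\<close>, to which \<open>N\<close> is
    orthogonal.\<close>
  have zero: "?G x = 0" if "x \<in> N" for x
  proof (rule ccontr)
    assume "?G x \<noteq> 0"
    have "N = (\<Inter>e\<in>U. {x. x \<bullet> e = 0})" by (auto simp: N_def)
    moreover have "closed {x :: 'a. x \<bullet> e = 0}" for e by (intro closed_Collect_eq continuous_intros)
    ultimately have "closed N" by auto
    moreover have "subspace N" by (auto simp: N_def subspace_def inner_add_left)
    moreover have "adjoint ?G (?G y) \<in> N" if "y \<in> N" for y
    proof -
      have "adjoint ?G (?G y) \<bullet> e = 0" if "s > 0" "e \<in> E s" for s e
      proof -
        have "adjoint ?G (?G y) \<bullet> e = y \<bullet> adjoint ?G (?G e)"
          by (metis hs_adjoint inner_commute)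
        also have "\<dots> = s\<^sup>2 * (y \<bullet> e)" using Es[OF that(2,1)] by (simp add: singular_space_def)
        finally show ?thesis using \<open>y \<in> N\<close> that by (auto simp: N_def U_def)
      qed
      then show ?thesis by (auto simp: N_def U_def)
    qed
    ultimately obtain s y where y: "s > 0" "y \<in> N" "y \<noteq> 0" "y \<in> singular_space G s"
      using singular_vector_exists[of N G x] \<open>x \<in> N\<close> \<open>?G x \<noteq> 0\<close> by metis
    have "orthogonal y y"
    proof (rule orthogonal_to_span)
      show "y \<in> span (E s)" using y span by simp
      show "orthogonal y e" if "e \<in> E s" for e
        using y that by (auto simp: N_def U_def orthogonal_def)
    qed
    then show False using y(3) by (simp add: orthogonal_self)
  qed
  have off: "?G e = 0" if "e \<in> B" "e \<notin> U" for e
    using that B orthonormal_inner[of B e] by (intro zero) (auto simp: N_def orthonormal_basis_def)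
  have fin_le: "ennreal (\<Sum>e\<in>F. ?K e \<bullet> ?G e) \<le> nuclear_norm G" if F: "finite F" "F \<subseteq> B" for F
  proof -
    define F' where "F' = F \<inter> U"
    have "finite F'" using F by (simp add: F'_def)
    \<comment> \<open>The singular values that occur in \<open>F'\<close>; each group of vectors
      with the same value is bounded by the multiplicity.\<close>
    define S where "S = (\<lambda>e. norm (?G e)) ` F'"
    have "finite S" using \<open>finite F'\<close> by (simp add: S_def)
    have Spos: "s > 0" if "s \<in> S" for s using that Ge by (auto simp: S_def F'_def U_def)
    have "S \<subseteq> singular_values G"
    proof
      fix s assume "s \<in> S"
      then obtain e t where e: "s = norm (?G e)" "t > 0" "e \<in> E t" by (auto simp: S_def F'_def U_def)
      then have "s = t" using Ge by simp
      moreover have "e \<noteq> 0" using on[OF e(2)] e(3) by (auto simp: orthonormal_def)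
      ultimately show "s \<in> singular_values G" using Es[OF e(3,2)] e(2) by (auto simp: singular_values_def)
    qed
    have "?K e \<bullet> ?G e = 0" if "e \<in> F - F'" for e
      using off[of e] that F(2) by (auto simp: F'_def)
    then have "(\<Sum>e\<in>F. ?K e \<bullet> ?G e) = (\<Sum>e\<in>F'. ?K e \<bullet> ?G e)"
      using F(1) by (intro sum.mono_neutral_right) (simp_all add: F'_def)
    also have "\<dots> \<le> (\<Sum>e\<in>F'. norm (?G e))"
    proof (rule sum_mono)
      fix e assume "e \<in> F'"
      then have "norm e = 1" using \<open>orthonormal U\<close> by (auto simp: F'_def orthonormal_def)
      then have "norm (?K e) \<le> 1" using norm_blinfun[of "blinfun_of_hs K" e] K by simp
      then show "?K e \<bullet> ?G e \<le> norm (?G e)"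
        using norm_cauchy_schwarz[of "?K e" "?G e"] mult_right_mono[of "norm (?K e)" 1 "norm (?G e)"] by simp
    qed
    also have "\<dots> = (\<Sum>s\<in>S. \<Sum>e\<in>{e \<in> F'. norm (?G e) = s}. norm (?G e))"
      unfolding S_def by (rule sum.image_gen[OF \<open>finite F'\<close>])
    also have "\<dots> \<le> (\<Sum>s\<in>S. real (dim (singular_space G s)) * s)"
    proof (rule sum_mono)
      fix s assume "s \<in> S"
      have "{e \<in> F'. norm (?G e) = s} \<subseteq> E s" using Ge by (auto simp: F'_def U_def)
      then have "card {e \<in> F'. norm (?G e) = s} \<le> dim (singular_space G s)"
        using card_mono[OF fin] card Spos[OF \<open>s \<in> S\<close>] by metis
      then show "(\<Sum>e\<in>{e \<in> F'. norm (?G e) = s}. norm (?G e)) \<le> real (dim (singular_space G s)) * s"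
        using Spos[OF \<open>s \<in> S\<close>] by (simp add: mult_right_mono)
    qed
    finally have "ennreal (\<Sum>e\<in>F. ?K e \<bullet> ?G e) \<le> ennreal (\<Sum>s\<in>S. real (dim (singular_space G s)) * s)"
      by (rule ennreal_leI)
    also have "\<dots> = (\<Sum>s\<in>S. of_nat (dim (singular_space G s)) * ennreal s)"
      using Spos by (simp add: sum_ennreal[symmetric] ennreal_mult less_imp_le ennreal_of_nat_eq_real_of_nat)
    also have "\<dots> \<le> nuclear_norm G" by (rule sum_le_nuclear_norm) fact+
    finally show ?thesis .
  qed
  show ?thesis
  proof (cases "nuclear_norm G")
    case (real r)
    have "inner K G \<le> r"
      unfolding inner_hs_eq[OF B(2)]
      by (intro infsum_le_finite_sums hilbert_schmidt_summable_inner hilbert_schmidt_hs_apply B)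
        (use fin_le real in simp)
    then show ?thesis using real by (simp add: ennreal_leI)
  qed simp
qed

text \<open>Here G^* G sends \<open>x\<close> to
  \<open>(\<sigma>\<^sup>2 * (u \<bullet> x)) *\<^sub>R u\<close>, so \<sigma> is the only possible
  singular value and its singular space lies in the line through \<open>u\<close>.\<close>

lemma nuclear_norm_tensor_le:
  assumes u: "norm u = 1" and v: "norm v = 1" and "\<sigma> > 0"
  shows "nuclear_norm (\<sigma> *\<^sub>R (u \<otimes> v)) \<le> ennreal \<sigma>"
proof -
  let ?G = "\<sigma> *\<^sub>R (u \<otimes> v)"
  have uu: "u \<bullet> u = 1" "v \<bullet> v = 1" using u v by (simp_all add: norm_eq_1)
  have A: "adjoint (hs_apply ?G) (hs_apply ?G x) = (\<sigma>\<^sup>2 * (u \<bullet> x)) *\<^sub>R u" for x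
    by (rule vector_eq_ldot[THEN iffD1])
      (simp add: hs_adjoint[symmetric] hs_apply_scaleR hs_tensor_apply uu power2_eq_square inner_commute)
  have sp: "x \<in> span {u} \<and> (x \<noteq> 0 \<longrightarrow> s = \<sigma>)" if "x \<in> singular_space ?G s" "s > 0" for x s
  proof -
    have eq: "s\<^sup>2 *\<^sub>R x = (\<sigma>\<^sup>2 * (u \<bullet> x)) *\<^sub>R u" using that(1) by (simp add: singular_space_def A)
    then have x: "x = ((\<sigma>\<^sup>2 * (u \<bullet> x)) / s\<^sup>2) *\<^sub>R u"
      using that(2) by (metis divide_inverse_commute divideR_right scaleR_scaleR zero_less_power less_irrefl)
    have "s = \<sigma>" if "x \<noteq> 0"
    proof -
      have "u \<bullet> x \<noteq> 0" using x that by auto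
      moreover have "s\<^sup>2 * (u \<bullet> x) = \<sigma>\<^sup>2 * (u \<bullet> x)"
        using arg_cong[OF eq, of "\<lambda>y. u \<bullet> y"] by (simp add: uu)
      ultimately show ?thesis using \<open>s > 0\<close> \<open>\<sigma> > 0\<close> by (simp add: power2_eq_iff_nonneg)
    qed
    moreover have "x \<in> span {u}" by (subst x) (intro span_scale span_base, simp)
    ultimately show ?thesis by blast
  qed
  have "singular_values ?G \<subseteq> {\<sigma>}" using sp by (auto simp: singular_values_def)
  then have "nuclear_norm ?G \<le> of_nat (dim (singular_space ?G \<sigma>)) * ennreal \<sigma>"
    unfolding nuclear_norm_def by (auto simp: subset_singleton_iff)
  also have "dim (singular_space ?G \<sigma>) \<le> 1"
    using dim_le_card[of "singular_space ?G \<sigma>" "{u}"] sp \<open>\<sigma> > 0\<close> by auto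
  then have "of_nat (dim (singular_space ?G \<sigma>)) * ennreal \<sigma> \<le> of_nat 1 * ennreal \<sigma>"
    by (intro mult_right_mono of_nat_mono) simp_all
  finally show ?thesis by simp
qed

subsection \<open>The tangent space\<close>

text \<open>\<open>normal_part u v G\<close> is \<open>(1 - v v\<^sup>*) G (1 - u u\<^sup>*)\<close>, the orthogonal projection of \<open>G\<close> onto the
  complement of \<open>{u \<otimes> a + b \<otimes> v}\<close>, expanded so that only rank-one corrections occur.\<close>

definition normal_part :: "'a::{real_inner, banach, second_countable_topology} \<Rightarrow>
    'b::{real_inner, banach, second_countable_topology} \<Rightarrow> ('a, 'b) hs \<Rightarrow> ('a, 'b) hs" where
  "normal_part u v G = G - u \<otimes> hs_apply G u - adjoint (hs_apply G) v \<otimes> v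
     + (v \<bullet> hs_apply G u) *\<^sub>R (u \<otimes> v)"

text \<open>The pointwise form is free of adjoints, so its continuity in \<open>G\<close> is
  visible.\<close>

lemma normal_part_apply:
  "hs_apply (normal_part u v G) x =
    hs_apply G x - (u \<bullet> x) *\<^sub>R hs_apply G u - (v \<bullet> hs_apply G x) *\<^sub>R v
      + ((v \<bullet> hs_apply G u) * (u \<bullet> x)) *\<^sub>R v"
  by (simp add: normal_part_def hs_apply_add hs_apply_diff hs_apply_scaleR hs_tensor_apply
      inner_commute[of "adjoint _ _"] hs_adjoint[symmetric] inner_commute[of "hs_apply _ _" v])

lemma normal_part_apply_left: "norm u = 1 \<Longrightarrow> hs_apply (normal_part u v G) u = 0"
  by (simp add: normal_part_apply norm_eq_1)

lemma normal_part_orthogonal_right: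
  "norm v = 1 \<Longrightarrow> hs_apply (normal_part u v G) x \<bullet> v = 0"
  by (simp add: normal_part_apply norm_eq_1 inner_diff_left inner_add_left inner_commute[of "hs_apply _ _" v])

text \<open>\<open>normal_part u v G\<close> annihilates \<open>u\<close> and has range orthogonal
  to \<open>v\<close>, so it pairs to zero with each rank-one term by which it differs from
  \<open>G\<close>.\<close>

lemma inner_normal_part:
  assumes "norm u = 1" "norm v = 1"
  shows "inner (normal_part u v G) G = (norm (normal_part u v G))\<^sup>2"
proof -
  let ?Q = "normal_part u v G"
  have "G = ?Q + u \<otimes> hs_apply G u + adjoint (hs_apply G) v \<otimes> v
      - (v \<bullet> hs_apply G u) *\<^sub>R (u \<otimes> v)"
    by (simp add: normal_part_def)
  then have "inner ?Q G = inner ?Q (?Q + u \<otimes> hs_apply G u + adjoint (hs_apply G) v \<otimes> v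
      - (v \<bullet> hs_apply G u) *\<^sub>R (u \<otimes> v))" by simp
  also have "\<dots> = inner ?Q ?Q"
    by (simp add: inner_add_right inner_diff_right inner_hs_tensor_right
        normal_part_apply_left normal_part_orthogonal_right assms)
  finally show ?thesis by (simp add: power2_norm_eq_inner)
qed

text \<open>The dual element is \<open>u \<otimes> v + M\<close>. The operator norm of
  \<open>sgn Q\<close> is at most its Hilbert--Schmidt norm, so \<open>M\<close> has operator norm
  at most 1, and \<open>sgn Q\<close> pairs with \<open>G\<close> to exactly
  \<open>norm Q\<close>.\<close>

lemma nuclear_norm_ge_certificate:
  assumes u: "norm u = 1" and v: "norm v = 1"
    and W: "hs_apply W u = 0" "adjoint (hs_apply W) v = 0" "norm (blinfun_of_hs W) \<le> 1"
  shows "ennreal (inner (u \<otimes> v + W) G + (1 - norm (blinfun_of_hs W)) * norm (normal_part u v G))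
    \<le> nuclear_norm G"
proof -
  define Q where "Q = normal_part u v G"
  define \<gamma> where "\<gamma> = 1 - norm (blinfun_of_hs W)"
  define M where "M = W + \<gamma> *\<^sub>R sgn Q"
  have uu: "u \<bullet> u = 1" "v \<bullet> v = 1" using u v by (simp_all add: norm_eq_1)
  have "\<gamma> \<ge> 0" using W(3) by (simp add: \<gamma>_def)
  have Mu: "hs_apply M u = 0"
    using W(1) u by (simp add: M_def Q_def hs_apply_add hs_apply_scaleR sgn_div_norm normal_part_apply_left)
  have Mv: "hs_apply M x \<bullet> v = 0" for x
    using W(2) v by (simp add: M_def Q_def hs_apply_add hs_apply_scaleR sgn_div_norm
        inner_add_left normal_part_orthogonal_right hs_adjoint[of W])
  have "norm (blinfun_of_hs M) \<le> norm (blinfun_of_hs W) + norm (blinfun_of_hs (\<gamma> *\<^sub>R sgn Q))"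
    unfolding M_def plus_hs.rep_eq by (rule norm_triangle_ineq)
  also have "norm (blinfun_of_hs (\<gamma> *\<^sub>R sgn Q)) \<le> norm (\<gamma> *\<^sub>R sgn Q)" by (rule norm_blinfun_of_hs_le)
  also have "\<dots> \<le> \<gamma>" using \<open>\<gamma> \<ge> 0\<close> by (simp add: norm_sgn)
  finally have M1: "norm (blinfun_of_hs M) \<le> 1" by (simp add: \<gamma>_def)
  \<comment> \<open>Pythagoras on both sides: \<open>u \<otimes> v\<close> sees only the component
    of \<open>x\<close> along \<open>u\<close> and \<open>M\<close> only the orthogonal rest
    \<open>y\<close>, while their values are orthogonal.\<close>
  have "norm (blinfun_of_hs (u \<otimes> v + M)) \<le> 1"
  proof (rule norm_blinfun_bound)
    fix x
    define y where "y = x - (u \<bullet> x) *\<^sub>R u"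
    have "hs_apply M x = hs_apply M y" by (simp add: y_def blinfun.diff_right blinfun.scaleR_right Mu)
    also have "norm \<dots> \<le> norm y"
      using norm_blinfun[of "blinfun_of_hs M" y] mult_right_mono[OF M1, of "norm y"] by simp
    finally have My: "(norm (hs_apply M x))\<^sup>2 \<le> (norm y)\<^sup>2" by (intro power_mono) auto
    have "(norm (hs_apply (u \<otimes> v + M) x))\<^sup>2 = (u \<bullet> x)\<^sup>2 + (norm (hs_apply M x))\<^sup>2"
      unfolding power2_norm_eq_inner
      by (simp add: hs_apply_add hs_tensor_apply inner_add_left inner_add_right Mv uu
          inner_commute[of v "hs_apply M x"] power2_eq_square)
    also have "\<dots> \<le> (u \<bullet> x)\<^sup>2 + (norm y)\<^sup>2" using My by simp
    also have "\<dots> = (norm x)\<^sup>2"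
    proof -
      have "y \<bullet> y = x \<bullet> x - (u \<bullet> x) * (u \<bullet> x)"
        unfolding y_def inner_diff_left inner_diff_right inner_scaleR_left inner_scaleR_right
          uu inner_commute[of x u] by simp
      then show ?thesis unfolding power2_norm_eq_inner power2_eq_square[of "u \<bullet> x"] by linarith
    qed
    finally show "norm (hs_apply (u \<otimes> v + M) x) \<le> 1 * norm x"
      unfolding mult_1_left by (rule power2_le_imp_le) simp
  qed simp
  then have "ennreal (inner (u \<otimes> v + M) G) \<le> nuclear_norm G" by (rule inner_le_nuclear_norm)
  moreover have "inner (sgn Q) G = norm Q"
    using inner_normal_part[OF u v, of G]
    by (cases "Q = 0") (simp_all add: Q_def[symmetric] sgn_div_norm power2_eq_square)
  ultimately show ?thesis
    by (simp add: M_def inner_add_left \<gamma>_def Q_def add.assoc)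
qed

lemma normal_part_tangent: "norm u = 1 \<Longrightarrow> norm v = 1 \<Longrightarrow> normal_part u v (u \<otimes> a + b \<otimes> v) = 0"
  by (intro hs_eqI) (simp add: normal_part_apply hs_apply_add hs_tensor_apply zero_hs.rep_eq norm_eq_1
      inner_add_right scaleR_add_left scaleR_add_right algebra_simps)

text \<open>This puts the tangential part into the form that \<open>tangent_space\<close> asks for;
  the correction by a multiple of \<open>u \<otimes> v\<close> is absorbed into the second
  tensor.\<close>

lemma diff_normal_part: "G - normal_part u v G =
    u \<otimes> hs_apply G u + (adjoint (hs_apply G) v - (v \<bullet> hs_apply G u) *\<^sub>R u) \<otimes> v"
  by (intro hs_eqI) (simp add: normal_part_def hs_apply_add hs_apply_diff hs_apply_scaleR hs_tensor_apply
      inner_diff_left scaleR_diff_left)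

lemma subspace_tangent_space: "subspace (tangent_space u v)"
proof -
  have add: "u \<otimes> a + b \<otimes> v + (u \<otimes> a' + b' \<otimes> v) = u \<otimes> (a + a') + (b + b') \<otimes> v"
    for u a b v and a' b'
    by (intro hs_eqI) (simp add: hs_apply_add hs_tensor_apply inner_add_left algebra_simps)
  have scale: "r *\<^sub>R (u \<otimes> a + b \<otimes> v) = u \<otimes> (r *\<^sub>R a) + (r *\<^sub>R b) \<otimes> v" for r u a b v
    by (intro hs_eqI) (simp add: hs_apply_add hs_apply_scaleR hs_tensor_apply scaleR_add_right)
  have zero: "0 = u \<otimes> 0 + 0 \<otimes> v" for u v
    by (intro hs_eqI) (simp add: hs_apply_add hs_tensor_apply zero_hs.rep_eq)
  show ?thesis
    unfolding subspace_def
  proof (intro conjI ballI allI)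
    show "0 \<in> tangent_space u v" unfolding tangent_space_def using zero by fastforce
    fix F G r assume F: "F \<in> tangent_space u v"
    show "r *\<^sub>R F \<in> tangent_space u v"
      unfolding tangent_space_def
    proof (intro CollectI allI)
      fix i
      obtain a b where "F $ i = u i \<otimes> a + b \<otimes> v i" using F unfolding tangent_space_def by blast
      then show "\<exists>a b. (r *\<^sub>R F) $ i = u i \<otimes> a + b \<otimes> v i"
        by (intro exI[of _ "r *\<^sub>R a"] exI[of _ "r *\<^sub>R b"]) (simp add: scale)
    qed
    assume G: "G \<in> tangent_space u v"
    show "F + G \<in> tangent_space u v"
      unfolding tangent_space_def
    proof (intro CollectI allI)
      fix i
      obtain a b a' b' where "F $ i = u i \<otimes> a + b \<otimes> v i" "G $ i = u i \<otimes> a' + b' \<otimes> v i"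
        using F G unfolding tangent_space_def by fast
      then show "\<exists>a b. (F + G) $ i = u i \<otimes> a + b \<otimes> v i"
        by (intro exI[of _ "a + a'"] exI[of _ "b + b'"]) (simp add: add)
    qed
  qed
qed

text \<open>Describing the space as a kernel replaces the existential quantifiers by equations, from
  which closedness follows by continuity.\<close>

lemma tangent_space_eq_normal_part:
  assumes "\<And>i. norm (u i) = 1" "\<And>i. norm (v i) = 1"
  shows "tangent_space u v = {F. \<forall>i. normal_part (u i) (v i) (F $ i) = 0}"
proof (intro equalityI subsetI CollectI allI)
  fix F i assume "F \<in> tangent_space u v"
  then obtain a b where "F $ i = u i \<otimes> a + b \<otimes> v i" unfolding tangent_space_def by blast
  then show "normal_part (u i) (v i) (F $ i) = 0" using normal_part_tangent assms by metis
next
  fix F assume F: "F \<in> {F. \<forall>i. normal_part (u i) (v i) (F $ i) = 0}"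
  show "F \<in> tangent_space u v"
    unfolding tangent_space_def
  proof (intro CollectI allI exI)
    fix i
    have "F $ i = F $ i - normal_part (u i) (v i) (F $ i)" using F by simp
    then show "F $ i = u i \<otimes> hs_apply (F $ i) (u i) +
        (adjoint (hs_apply (F $ i)) (v i) - (v i \<bullet> hs_apply (F $ i) (u i)) *\<^sub>R u i) \<otimes> v i"
      unfolding diff_normal_part .
  qed
qed

lemma closed_tangent_space:
  assumes "\<And>i. norm (u i) = 1" "\<And>i. norm (v i) = 1"
  shows "closed (tangent_space u v)"
proof -
  have "normal_part (u i) (v i) G = 0 \<longleftrightarrow> (\<forall>x. hs_apply (normal_part (u i) (v i) G) x = 0)" for i G
    using hs_eqI[of "normal_part (u i) (v i) G" 0] by (auto simp: zero_hs.rep_eq)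
  moreover have cont: "continuous_on UNIV (\<lambda>F. hs_apply (F $ i) x)" for i x
    by (intro bounded_linear.continuous_on[OF bounded_linear_hs_apply] continuous_on_component continuous_on_id)
  ultimately show ?thesis
    unfolding tangent_space_eq_normal_part[OF assms]
    by (simp only: normal_part_apply)
      (intro closed_Collect_all closed_Collect_eq continuous_on_add continuous_on_diff
        continuous_on_scaleR continuous_on_mult continuous_on_inner continuous_on_const
        continuous_on_id cont)
qed

subsection \<open>Convergence rate\<close>

lemma ennreal_max_zero: "ennreal (max 0 x) = ennreal x"
  by (cases "0 \<le> x") (simp_all add: ennreal_neg)

text \<open>Equality can fail because \<open>ennreal\<close> maps negative summands to 0.\<close>

lemma ennreal_sum_le: "ennreal (\<Sum>i\<in>A. f i) \<le> (\<Sum>i\<in>A. ennreal (f i))"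
proof -
  have "ennreal (\<Sum>i\<in>A. f i) \<le> ennreal (\<Sum>i\<in>A. max 0 (f i))"
    by (intro ennreal_leI sum_mono) simp
  also have "\<dots> = (\<Sum>i\<in>A. ennreal (f i))"
    using sum_ennreal[of A "\<lambda>i. max 0 (f i)"] by (simp add: ennreal_max_zero)
  finally show ?thesis .
qed

theorem proposition3p7:
  fixes \<Phi> :: "('a::{real_inner, banach, second_countable_topology},
               'b::{real_inner, banach, second_countable_topology}) hs ^ 'n::finite
             \<Rightarrow> 'h::{real_inner, banach, second_countable_topology}"
    and u :: "'n \<Rightarrow> 'a" and v :: "'n \<Rightarrow> 'b" and \<sigma> :: "'n \<Rightarrow> real"
    and F\<^sub>0 :: "('a, 'b) hs ^ 'n" and z :: 'h and c :: real
  assumes "bounded_linear \<Phi>"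
    and "\<And>i. norm (u i) = 1" and "\<And>i. norm (v i) = 1" and "\<And>i. \<sigma> i > 0"
    and "F\<^sub>0 = (\<chi> i. \<sigma> i *\<^sub>R (u i \<otimes> v i))"
    and "z = \<Phi> F\<^sub>0"
    and "c > 0"
    and "inj_on \<Phi> (tangent_space u v)"
    and "closed (\<Phi> ` tangent_space u v)"
    and "ndsc \<Phi> u v"
  shows "\<exists>C>0. \<forall>\<delta>>0. \<forall>z\<^sub>\<delta>. norm (z\<^sub>\<delta> - z) \<le> \<delta> \<longrightarrow>
    (\<forall>F\<^sub>\<delta>. is_arg_min (objective \<Phi> z\<^sub>\<delta> (c * \<delta>)) (\<lambda>_. True) F\<^sub>\<delta> \<longrightarrow>
      (\<Sum>i\<in>UNIV. norm ((F\<^sub>\<delta> - F\<^sub>0) $ i)) \<le> C * \<delta>)"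
proof -
  interpret \<Phi>: bounded_linear \<Phi> by fact
  note u = assms(2) and v = assms(3) and \<sigma> = assms(4) and F\<^sub>0 = assms(5) and z = assms(6)
  have F0i: "F\<^sub>0 $ i = \<sigma> i *\<^sub>R (u i \<otimes> v i)" for i by (simp add: F\<^sub>0)
  from \<open>ndsc \<Phi> u v\<close> obtain p where "\<forall>i. \<exists>W. adjoint \<Phi> p $ i = u i \<otimes> v i + W \<and>
     hs_apply W (u i) = 0 \<and> adjoint (hs_apply W) (v i) = 0 \<and> norm (blinfun_of_hs W) < 1"
    unfolding ndsc_def by (elim bexE rangeE) simp
  then obtain W where H: "\<And>i. adjoint \<Phi> p $ i = u i \<otimes> v i + W i"
    and W: "\<And>i. hs_apply (W i) (u i) = 0" "\<And>i. adjoint (hs_apply (W i)) (v i) = 0"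
      "\<And>i. norm (blinfun_of_hs (W i)) < 1"
    by (simp only: choice_iff) blast
  obtain \<kappa> where "\<kappa> \<ge> 0" and \<kappa>: "\<And>F. F \<in> tangent_space u v \<Longrightarrow> norm F \<le> \<kappa> * norm (\<Phi> F)"
    using closed_range_bounded_below[OF assms(1) subspace_tangent_space closed_tangent_space[OF u v]
        assms(8,9)] by blast
  \<comment> \<open>One gap below 1 that serves all components, positive because there are finitely
    many.\<close>
  define \<gamma> where "\<gamma> = Min (range (\<lambda>i. 1 - norm (blinfun_of_hs (W i))))"
  have "\<gamma> > 0" unfolding \<gamma>_def using W(3) by (subst Min_gr_iff) auto
  have \<gamma>: "\<gamma> \<le> 1 - norm (blinfun_of_hs (W i))" for i unfolding \<gamma>_def by (rule Min_le) auto
  define P where "P = norm p"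
  define B where "B = onorm \<Phi>"
  \<comment> \<open>\<open>C0 * \<delta>\<close> will bound the normal part of \<open>F\<^sub>\<delta>\<close>.\<close>
  define C0 where "C0 = (1/2 + c * P + (c * P)\<^sup>2 / 2) / (c * \<gamma>)"
  define N where "N = real CARD('n)"
  \<comment> \<open>The first summand collects the tangential part over all components,
    \<open>C0\<close> the normal part; the added 1 makes \<open>C\<close> positive.\<close>
  define C where "C = N * (\<kappa> * (2 + 2 * c * P + B * C0)) + C0 + 1"
  have "P \<ge> 0" "B \<ge> 0" "N \<ge> 0" by (simp_all add: P_def B_def N_def onorm_pos_le assms(1))
  have "C0 \<ge> 0" using \<open>c > 0\<close> \<open>\<gamma> > 0\<close> \<open>P \<ge> 0\<close> by (simp add: C0_def)
  have "C > 0"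
    using \<open>c > 0\<close> \<open>\<kappa> \<ge> 0\<close> \<open>C0 \<ge> 0\<close> \<open>P \<ge> 0\<close> \<open>B \<ge> 0\<close> \<open>N \<ge> 0\<close>
    by (simp add: C_def add_nonneg_pos)
  \<comment> \<open>The certificate is the image of \<open>p\<close> under the adjoint, so its
    pairing with \<open>F\<close> depends on \<open>F\<close> only through
    \<open>\<Phi> F\<close>.\<close>
  have dual: "(\<Sum>i\<in>UNIV. inner (u i \<otimes> v i + W i) (F $ i)) = p \<bullet> \<Phi> F" for F
    using adjoint_works_hilbert[OF assms(1), of F p]
    by (simp add: inner_vec_def H[symmetric] inner_commute[of "F $ _"] inner_commute[of "\<Phi> F"])
  \<comment> \<open>The certificate is tight at \<open>F\<^sub>0\<close>: \<open>W i\<close>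
    annihilates \<open>u i\<close>, so only the rank-one part contributes.\<close>
  have "inner (u i \<otimes> v i + W i) (F\<^sub>0 $ i) = \<sigma> i" for i
    using u[of i] v[of i]
    by (simp add: F0i inner_hs_tensor_right hs_apply_add hs_tensor_apply W norm_eq_1)
  then have sum_\<sigma>: "(\<Sum>i\<in>UNIV. \<sigma> i) = p \<bullet> z" using dual[of F\<^sub>0] by (simp add: z)
  have "(\<Sum>i\<in>UNIV. norm ((F\<^sub>\<delta> - F\<^sub>0) $ i)) \<le> C * \<delta>"
    if "\<delta> > 0" and z\<delta>: "norm (z\<^sub>\<delta> - z) \<le> \<delta>"
      and min: "is_arg_min (objective \<Phi> z\<^sub>\<delta> (c * \<delta>)) (\<lambda>_. True) F\<^sub>\<delta>" for \<delta> z\<^sub>\<delta> F\<^sub>\<delta>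
  proof -
    define lam where "lam = c * \<delta>"
    have "lam > 0" using \<open>c > 0\<close> \<open>\<delta> > 0\<close> by (simp add: lam_def)
    define Q where "Q = (\<chi> i. normal_part (u i) (v i) (F\<^sub>\<delta> $ i))"
    define S where "S = (\<Sum>i\<in>UNIV. norm (Q $ i))"
    define R where "R = \<Phi> F\<^sub>\<delta> - z\<^sub>\<delta>"
    define r where "r = norm R"
    define t where "t = p \<bullet> \<Phi> F\<^sub>\<delta> + \<gamma> * S"
    have "S \<ge> 0" "r \<ge> 0" by (simp_all add: S_def r_def sum_nonneg)
    have "ennreal t \<le> (\<Sum>i\<in>UNIV. ennreal (inner (u i \<otimes> v i + W i) (F\<^sub>\<delta> $ i) + \<gamma> * norm (Q $ i)))"
      unfolding t_def S_def dual[symmetric] sum_distrib_left sum.distrib[symmetric] by (rule ennreal_sum_le)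
    also have "\<dots> \<le> (\<Sum>i\<in>UNIV. nuclear_norm (F\<^sub>\<delta> $ i))"
    proof (rule sum_mono)
      fix i
      have "ennreal (inner (u i \<otimes> v i + W i) (F\<^sub>\<delta> $ i) + \<gamma> * norm (Q $ i)) \<le>
          ennreal (inner (u i \<otimes> v i + W i) (F\<^sub>\<delta> $ i)
            + (1 - norm (blinfun_of_hs (W i))) * norm (normal_part (u i) (v i) (F\<^sub>\<delta> $ i)))"
        using \<gamma>[of i] by (intro ennreal_leI add_left_mono) (simp add: Q_def mult_right_mono)
      also have "\<dots> \<le> nuclear_norm (F\<^sub>\<delta> $ i)"
        using W(3)[of i] by (intro nuclear_norm_ge_certificate u v W) simp
      finally show "ennreal (inner (u i \<otimes> v i + W i) (F\<^sub>\<delta> $ i) + \<gamma> * norm (Q $ i))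
        \<le> nuclear_norm (F\<^sub>\<delta> $ i)" .
    qed
    finally have lower: "ennreal t \<le> (\<Sum>i\<in>UNIV. nuclear_norm (F\<^sub>\<delta> $ i))" .
    have "(\<Sum>i\<in>UNIV. nuclear_norm (F\<^sub>0 $ i)) \<le> (\<Sum>i\<in>UNIV. ennreal (\<sigma> i))"
      unfolding F0i by (intro sum_mono nuclear_norm_tensor_le u v \<sigma>)
    also have "\<dots> = ennreal (p \<bullet> z)"
      unfolding sum_\<sigma>[symmetric] using \<sigma> by (intro sum_ennreal) (simp add: less_imp_le)
    finally have upper: "(\<Sum>i\<in>UNIV. nuclear_norm (F\<^sub>0 $ i)) \<le> ennreal (p \<bullet> z)" .
    have "p \<bullet> z \<ge> 0" unfolding sum_\<sigma>[symmetric] using \<sigma> by (intro sum_nonneg) (simp add: less_imp_le)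
    \<comment> \<open>\<open>t\<close> may be negative, but \<open>ennreal t\<close> equals
      \<open>ennreal (max 0 t)\<close>; with nonnegative arguments the comparison of objectives can
      be brought back from \<open>ennreal\<close> to the reals.\<close>
    have "ennreal (1/2 * r\<^sup>2 + lam * max 0 t) = ennreal (1/2 * r\<^sup>2) + ennreal lam * ennreal t"
      using \<open>lam > 0\<close> ennreal_mult[of lam "max 0 t"]
      by (simp add: ennreal_plus ennreal_max_zero)
    also have "\<dots> \<le> objective \<Phi> z\<^sub>\<delta> (c * \<delta>) F\<^sub>\<delta>"
      unfolding objective_def lam_def[symmetric] R_def r_def
      by (intro add_left_mono mult_left_mono lower) simp
    also have "\<dots> \<le> objective \<Phi> z\<^sub>\<delta> (c * \<delta>) F\<^sub>0" using min by (auto simp: is_arg_min_def not_less)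
    also have "\<dots> \<le> ennreal (1/2 * \<delta>\<^sup>2) + ennreal lam * ennreal (p \<bullet> z)"
      unfolding objective_def lam_def[symmetric] z[symmetric]
    proof (intro add_mono mult_left_mono upper ennreal_leI)
      show "(norm (z - z\<^sub>\<delta>))\<^sup>2 \<le> \<delta>\<^sup>2" using z\<delta> by (intro power_mono) (simp_all add: norm_minus_commute)
    qed simp_all
    also have "\<dots> = ennreal (1/2 * \<delta>\<^sup>2 + lam * (p \<bullet> z))"
      using \<open>lam > 0\<close> \<open>p \<bullet> z \<ge> 0\<close> by (simp add: ennreal_plus ennreal_mult[symmetric])
    finally have "1/2 * r\<^sup>2 + lam * max 0 t \<le> 1/2 * \<delta>\<^sup>2 + lam * (p \<bullet> z)"
      using \<open>lam > 0\<close> \<open>p \<bullet> z \<ge> 0\<close> by (subst (asm) ennreal_le_iff) simp_all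
    moreover have "lam * t \<le> lam * max 0 t" using \<open>lam > 0\<close> by simp
    ultimately have opt: "1/2 * r\<^sup>2 + lam * (p \<bullet> (\<Phi> F\<^sub>\<delta> - z)) + lam * (\<gamma> * S) \<le> 1/2 * \<delta>\<^sup>2"
      by (simp add: t_def inner_diff_right algebra_simps)
    have split: "\<Phi> F\<^sub>\<delta> - z = R + (z\<^sub>\<delta> - z)" by (simp add: R_def)
    have "- (P * (r + \<delta>)) \<le> p \<bullet> (\<Phi> F\<^sub>\<delta> - z)"
    proof -
      have "\<bar>p \<bullet> (\<Phi> F\<^sub>\<delta> - z)\<bar> \<le> P * norm (\<Phi> F\<^sub>\<delta> - z)" unfolding P_def by (rule Cauchy_Schwarz_ineq2)
      also have "norm (\<Phi> F\<^sub>\<delta> - z) \<le> r + \<delta>"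
        unfolding split r_def using norm_triangle_ineq[of R "z\<^sub>\<delta> - z"] z\<delta> by linarith
      finally show ?thesis using \<open>P \<ge> 0\<close> by (auto simp: mult_left_mono)
    qed
    from mult_left_mono[OF this, of lam]
    have main: "1/2 * r\<^sup>2 - lam * P * r - lam * P * \<delta> + lam * \<gamma> * S \<le> 1/2 * \<delta>\<^sup>2"
      using opt \<open>lam > 0\<close> by (simp add: algebra_simps)
    \<comment> \<open>The square absorbs the linear term in \<open>r\<close>. As \<open>lam\<close>
      is proportional to \<delta>, all that remains on the right is of order \<delta>^2, while the
      coefficient of \<open>S\<close> is of order \<delta>.\<close>
    have S_le: "S \<le> C0 * \<delta>"
    proof -
      have "0 \<le> 1/2 * (r - lam * P)\<^sup>2" by simp
      with main have "lam * \<gamma> * S \<le> 1/2 * \<delta>\<^sup>2 + lam * P * \<delta> + (lam * P)\<^sup>2 / 2"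
        by (simp add: power2_diff power2_eq_square algebra_simps)
      also have "\<dots> = \<delta> * ((c * \<gamma>) * (C0 * \<delta>))"
        using \<open>c > 0\<close> \<open>\<gamma> > 0\<close> by (simp add: C0_def lam_def power2_eq_square field_simps)
      finally have "(\<delta> * (c * \<gamma>)) * S \<le> (\<delta> * (c * \<gamma>)) * (C0 * \<delta>)" by (simp add: lam_def mult_ac)
      then show ?thesis by (rule mult_left_le_imp_le) (use \<open>c > 0\<close> \<open>\<gamma> > 0\<close> \<open>\<delta> > 0\<close> in simp)
    qed
    \<comment> \<open>With the term in \<open>S\<close> dropped, \<open>main\<close> says \<open>r *
      (r - 2 * lam * P) \<le> (\<delta> + 2 * lam * P) * \<delta>\<close>, which fails for larger
      \<open>r\<close>.\<close>
    have r_le: "r \<le> \<delta> + 2 * lam * P"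
    proof (rule ccontr)
      assume "\<not> ?thesis"
      then have "\<delta> + 2 * lam * P < r" by simp
      moreover have "lam * P \<ge> 0" using \<open>lam > 0\<close> \<open>P \<ge> 0\<close> by simp
      ultimately have "(\<delta> + 2 * lam * P) * \<delta> < r * (r - 2 * lam * P)"
        using \<open>\<delta> > 0\<close> by (intro mult_strict_mono) auto
      moreover have "lam * \<gamma> * S \<ge> 0" using \<open>lam > 0\<close> \<open>\<gamma> > 0\<close> \<open>S \<ge> 0\<close> by simp
      ultimately show False using main by (simp add: power2_eq_square algebra_simps)
    qed
    \<comment> \<open>\<open>F\<^sub>\<delta> - Q\<close> is the tangential part of
      \<open>F\<^sub>\<delta>\<close> and \<open>F\<^sub>0\<close> is itself tangent, so the
      estimate with \<kappa> applies to the difference.\<close>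
    have "F\<^sub>\<delta> - F\<^sub>0 - Q \<in> tangent_space u v"
    proof -
      have "F\<^sub>\<delta> - Q \<in> tangent_space u v"
        unfolding tangent_space_def
      proof (intro CollectI allI exI)
        show "(F\<^sub>\<delta> - Q) $ i = u i \<otimes> hs_apply (F\<^sub>\<delta> $ i) (u i) + (adjoint (hs_apply (F\<^sub>\<delta> $ i)) (v i)
            - (v i \<bullet> hs_apply (F\<^sub>\<delta> $ i) (u i)) *\<^sub>R u i) \<otimes> v i" for i
          by (simp add: Q_def diff_normal_part)
      qed
      moreover have "F\<^sub>0 \<in> tangent_space u v"
        unfolding tangent_space_def
      proof (intro CollectI allI exI)
        show "F\<^sub>0 $ i = u i \<otimes> (\<sigma> i *\<^sub>R v i) + 0 \<otimes> v i" for i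
          by (intro hs_eqI) (simp add: F0i hs_apply_add hs_apply_scaleR hs_tensor_apply mult.commute)
      qed
      ultimately have "F\<^sub>\<delta> - Q - F\<^sub>0 \<in> tangent_space u v"
        by (rule subspace_diff[OF subspace_tangent_space])
      then show ?thesis by (simp add: algebra_simps)
    qed
    from \<kappa>[OF this] have "norm (F\<^sub>\<delta> - F\<^sub>0 - Q) \<le> \<kappa> * norm (\<Phi> (F\<^sub>\<delta> - F\<^sub>0 - Q))" .
    \<comment> \<open>The data term costs \<open>r + \<delta>\<close>, at most
      \<open>2 * \<delta> + 2 * lam * P\<close>, and removing \<open>Q\<close> costs at most
      \<open>B * (C0 * \<delta>)\<close>.\<close>
    also have "norm (\<Phi> (F\<^sub>\<delta> - F\<^sub>0 - Q)) \<le> (2 + 2 * c * P + B * C0) * \<delta>"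
    proof -
      have eq: "\<Phi> (F\<^sub>\<delta> - F\<^sub>0 - Q) = R + (z\<^sub>\<delta> - z) - \<Phi> Q" by (simp add: \<Phi>.diff z R_def)
      have "norm (\<Phi> (F\<^sub>\<delta> - F\<^sub>0 - Q)) \<le> r + \<delta> + norm (\<Phi> Q)"
        using norm_triangle_ineq4[of "R + (z\<^sub>\<delta> - z)" "\<Phi> Q"] norm_triangle_ineq[of R "z\<^sub>\<delta> - z"] z\<delta>
        unfolding r_def eq by linarith
      moreover have "norm (\<Phi> Q) \<le> B * (C0 * \<delta>)"
      proof -
        have "norm Q \<le> S" unfolding norm_vec_def S_def by (rule L2_set_le_sum) simp
        then have "B * norm Q \<le> B * (C0 * \<delta>)" using S_le \<open>B \<ge> 0\<close> by (intro mult_left_mono) auto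
        then show ?thesis using onorm[OF assms(1), of Q] by (simp add: B_def)
      qed
      ultimately show ?thesis using r_le by (simp add: lam_def algebra_simps)
    qed
    finally have tan: "norm (F\<^sub>\<delta> - F\<^sub>0 - Q) \<le> \<kappa> * ((2 + 2 * c * P + B * C0) * \<delta>)"
      using \<open>\<kappa> \<ge> 0\<close> by (simp add: mult_left_mono)
    \<comment> \<open>Each component of the tangential remainder is bounded by the norm of the whole
      vector, whence the factor \<open>N\<close>.\<close>
    have "(\<Sum>i\<in>UNIV. norm ((F\<^sub>\<delta> - F\<^sub>0) $ i)) \<le> (\<Sum>i\<in>(UNIV :: 'n set). norm (F\<^sub>\<delta> - F\<^sub>0 - Q) + norm (Q $ i))"
    proof (rule sum_mono)
      fix i
      have eq: "(F\<^sub>\<delta> - F\<^sub>0) $ i = (F\<^sub>\<delta> - F\<^sub>0 - Q) $ i + Q $ i" by simp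
      show "norm ((F\<^sub>\<delta> - F\<^sub>0) $ i) \<le> norm (F\<^sub>\<delta> - F\<^sub>0 - Q) + norm (Q $ i)"
        unfolding eq using norm_triangle_ineq[of "(F\<^sub>\<delta> - F\<^sub>0 - Q) $ i" "Q $ i"]
          Finite_Cartesian_Product.norm_nth_le[of "F\<^sub>\<delta> - F\<^sub>0 - Q" i] by linarith
    qed
    also have "\<dots> = N * norm (F\<^sub>\<delta> - F\<^sub>0 - Q) + S" by (simp add: sum.distrib S_def N_def)
    also have "\<dots> \<le> N * (\<kappa> * ((2 + 2 * c * P + B * C0) * \<delta>)) + C0 * \<delta>"
      using tan S_le \<open>N \<ge> 0\<close> by (intro add_mono mult_left_mono)
    also have "\<dots> \<le> C * \<delta>" using \<open>\<delta> > 0\<close> by (simp add: C_def algebra_simps)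
    finally show ?thesis .
  qed
  then show ?thesis using \<open>C > 0\<close> by blast
qed

end
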